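(* Let $(V,g)$ be a real vector space of dimension $n+1$, $n\in\mathbb N$, with a positive definite inner product $g$ and a unit vector $\xi$; let $U=\mathrm{span}(\xi)$ and $D=U^\perp$. The $\mathrm{SO}(n)$-module $\mathcal{II}(V)=D^*\otimes U^*\otimes D^*$ decomposes into $\mathrm{SO}(n)$-irreducible submodules as $$\mathcal{II}(V)=\mathcal{II}_1(V)+\mathcal{II}_2(V)+\mathcal{II}_3(V),$$ with explicit expressions $$\begin{aligned} \mathcal{II}_1(V)&=\{S\in\mathcal{II}(V): S_{XYZ}=\lambda\, g(X,Z)g(Y,\xi),\ \lambda\in\mathbb R\},\\ \mathcal{II}_2(V)&=\{S\in\mathcal{II}(V): S_{XYZ}=g(Y,\xi)S_{X\xi Z},\ S_{X\xi Z}=S_{Z\xi X},\ c_{13}(S)=0\},\\ \mathcal{II}_3(V)&=\{S\in\mathcal{II}(V): S_{XYZ}=g(Y,\xi)S_{X\xi Z},\ S_{X\xi Z}=-S_{Z\xi X}\}, \end{aligned}$$ where $c_{13}(S)(Y)=\sum_{i=1}^nS_{e_iYe_i}$ for any orthonormal basis $\{e_1,\dots,e_n\}$ of $D$.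
   Context: $\mathrm{SO}(n)=\mathrm{SO}(D)$ acts on $V=U\oplus D$ fixing $\xi$ and in the standard way on $D$, and acts on tensors accordingly. Elements of $D^*\otimes U^*\otimes D^*$ are trilinear forms $S_{XYZ}$ with $X,Z\in D$ and $Y\in U$ (extended by zero to $Y\in D$); the defining identities are understood for all $X,Z\in D$ and $Y\in V$.
   Formalization: Irreducibility of II_3(V) is not claimed for n = 4, where it fails (it splits into self-dual and anti-self-dual forms); for n = 0 all three summands, and for n = 1 II_2(V) and II_3(V), are stated to be {0} instead of irreducible. *)

theory Defs
  imports "Jordan_Normal_Form.Determinant" "HOL-Analysis.Analysis"
begin

text \<open>
  A type of class \<^class>\<open>euclidean_space\<close> plays the role of the finite-dimensional inner product
  space \<open>(V, g)\<close>, with \<open>g = (\<bullet>)\<close>; linear maps on it are automatically bounded, so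
  \<open>V\<^sup>* \<otimes> V\<^sup>* \<otimes> V\<^sup>*\<close> is the following real vector space.
\<close>

type_synonym 'v trilinear_form = "'v \<Rightarrow>\<^sub>L 'v \<Rightarrow>\<^sub>L 'v \<Rightarrow>\<^sub>L real"

definition U :: "'v::euclidean_space \<Rightarrow> 'v set" where
  "U \<xi> = span {\<xi>}"

definition D :: "'v::euclidean_space \<Rightarrow> 'v set" where
  "D \<xi> = (U \<xi>)\<^sup>\<bottom>"

text \<open>Only the values \<open>e i\<close> with \<open>i < dim W\<close> matter.\<close>

definition orthonormal_basis :: "'v::euclidean_space set \<Rightarrow> (nat \<Rightarrow> 'v) \<Rightarrow> bool" where
  "orthonormal_basis W e \<longleftrightarrow>
     (\<forall>i<dim W. \<forall>j<dim W. e i \<bullet> e j = (if i = j then 1 else 0)) \<and>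
     span (e ` {..<dim W}) = W"

definition some_onb :: "'v::euclidean_space set \<Rightarrow> nat \<Rightarrow> 'v" where
  "some_onb W = (SOME e. orthonormal_basis W e)"

lemma some_onb:
  fixes W :: "'v::euclidean_space set"
  assumes "subspace W"
  shows "orthonormal_basis W (some_onb W)"
proof -
  obtain B where B: "B \<subseteq> W" "pairwise orthogonal B" "\<And>x. x \<in> B \<Longrightarrow> norm x = 1"
      "independent B" "card B = dim W" "span B = W"
    using orthonormal_basis_subspace[OF assms] by metis
  have "finite B" using B(4) by (rule independent_imp_finite)
  then obtain e where e: "bij_betw e {0..<card B} B"
    using ex_bij_betw_nat_finite by blast
  have img: "e ` {..<dim W} = B"
    using e B(5) by (simp add: bij_betw_def lessThan_atLeast0)
  have "e i \<bullet> e j = (if i = j then 1 else 0)" if "i < dim W" "j < dim W" for i j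
  proof (cases "i = j")
    case True
    have "e i \<in> B" using img that by blast
    then show ?thesis using True B(3) by (simp add: norm_eq_1)
  next
    case False
    have "e i \<noteq> e j"
      using e False that B(5) by (auto simp: bij_betw_def dest: inj_onD)
    moreover have "e i \<in> B" "e j \<in> B" using img that by blast+
    ultimately show ?thesis using False B(2) by (auto simp: pairwise_def orthogonal_def)
  qed
  then have "orthonormal_basis W e"
    using img B(6) by (simp add: orthonormal_basis_def)
  then show ?thesis unfolding some_onb_def by (rule someI[of "orthonormal_basis W"])
qed

definition matrix_wrt :: "nat \<Rightarrow> (nat \<Rightarrow> 'v::euclidean_space) \<Rightarrow> ('v \<Rightarrow> 'v) \<Rightarrow> real Matrix.mat" where
  "matrix_wrt n e h = Matrix.mat n n (\<lambda>(i, j). e i \<bullet> h (e j))"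

text \<open>The determinant of a linear map that preserves \<open>W\<close>, restricted to \<open>W\<close>.\<close>

definition det_on :: "'v::euclidean_space set \<Rightarrow> ('v \<Rightarrow> 'v) \<Rightarrow> real" where
  "det_on W h = Determinant.det (matrix_wrt (dim W) (some_onb W) h)"

lemma orthonormal_basis_expand:
  assumes e: "orthonormal_basis W e" and x: "x \<in> W"
  shows "x = (\<Sum>i<dim W. (e i \<bullet> x) *\<^sub>R e i)"
proof -
  let ?y = "x - (\<Sum>i<dim W. (e i \<bullet> x) *\<^sub>R e i)"
  have W: "span (e ` {..<dim W}) = W"
    using e by (simp add: orthonormal_basis_def)
  have "e j \<bullet> ?y = 0" if "j < dim W" for j
  proof -
    have "e j \<bullet> (\<Sum>i<dim W. (e i \<bullet> x) *\<^sub>R e i) = (\<Sum>i<dim W. (e i \<bullet> x) * (if j = i then 1 else 0))"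
      using e that unfolding inner_sum_right by (intro sum.cong) (auto simp: orthonormal_basis_def)
    also have "\<dots> = e j \<bullet> x" using that by (simp add: if_distrib cong: if_cong)
    finally show ?thesis by (simp add: inner_diff_right)
  qed
  then have "orthogonal ?y v" if "v \<in> e ` {..<dim W}" for v
    using that by (auto simp: orthogonal_def inner_commute)
  then have orth: "orthogonal ?y v" if "v \<in> span (e ` {..<dim W})" for v
    using that by (intro orthogonal_to_span[of v "e ` {..<dim W}"])
  have "?y \<in> W"
  proof -
    have "(\<Sum>i<dim W. (e i \<bullet> x) *\<^sub>R e i) \<in> span (e ` {..<dim W})"
      by (intro span_sum span_scale span_base) auto
    then have "(\<Sum>i<dim W. (e i \<bullet> x) *\<^sub>R e i) \<in> W" by (simp only: W)
    moreover have "subspace W" using subspace_span[of "e ` {..<dim W}"] by (simp only: W)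
    ultimately show ?thesis using x subspace_diff by blast
  qed
  then have "?y \<in> span (e ` {..<dim W})" by (simp only: W)
  from orth[OF this] have "?y = 0" by (simp only: orthogonal_self)
  then show ?thesis by simp
qed

lemma det_on_eq:
  fixes W :: "'v::euclidean_space set"
  assumes W: "subspace W" and lin: "linear h" and inv: "h ` W \<subseteq> W" and e: "orthonormal_basis W e"
  shows "det_on W h = Determinant.det (matrix_wrt (dim W) e h)"
proof -
  let ?n = "dim W"
  define b where "b = some_onb W"
  have b: "orthonormal_basis W b" unfolding b_def by (rule some_onb[OF W])
  have eW: "e i \<in> W" if "i < ?n" for i
    using e that span_base[of "e i" "e ` {..<?n}"] by (auto simp: orthonormal_basis_def)
  define P where "P = Matrix.mat ?n ?n (\<lambda>(i, j). b i \<bullet> e j)"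
  have P: "P \<in> carrier_mat ?n ?n" by (simp add: P_def)
  have M: "matrix_wrt ?n f h \<in> carrier_mat ?n ?n" for f by (simp add: matrix_wrt_def)
  have exp: "x \<bullet> y = (\<Sum>k<?n. (b k \<bullet> x) * (b k \<bullet> y))" if "x \<in> W" for x y
  proof -
    have "x \<bullet> y = (\<Sum>k<?n. (b k \<bullet> x) *\<^sub>R b k) \<bullet> y"
      using orthonormal_basis_expand[OF b that] by simp
    then show ?thesis by (simp add: inner_sum_left)
  qed
  have PP: "transpose_mat P * P = 1\<^sub>m ?n"
  proof (rule eq_matI)
    fix i j assume "i < dim_row (1\<^sub>m ?n :: real Matrix.mat)" "j < dim_col (1\<^sub>m ?n :: real Matrix.mat)"
    then have ij: "i < ?n" "j < ?n" by auto
    have "(transpose_mat P * P) $$ (i, j) = (\<Sum>k<?n. (b k \<bullet> e i) * (b k \<bullet> e j))"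
      using ij by (simp add: P_def scalar_prod_def lessThan_atLeast0)
    also have "\<dots> = e i \<bullet> e j" using exp[OF eW[OF ij(1)]] by simp
    finally show "(transpose_mat P * P) $$ (i, j) = 1\<^sub>m ?n $$ (i, j)"
      using e ij by (simp add: orthonormal_basis_def)
  qed (auto simp: P_def)
  have "P * matrix_wrt ?n e h = matrix_wrt ?n b h * P"
  proof (rule eq_matI)
    fix i j assume "i < dim_row (matrix_wrt ?n b h * P)" "j < dim_col (matrix_wrt ?n b h * P)"
    then have ij: "i < ?n" "j < ?n" by (auto simp: P_def matrix_wrt_def)
    have "(P * matrix_wrt ?n e h) $$ (i, j) = (\<Sum>k<?n. (b i \<bullet> e k) * (e k \<bullet> h (e j)))"
      using ij by (simp add: P_def matrix_wrt_def scalar_prod_def lessThan_atLeast0)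
    also have "\<dots> = b i \<bullet> (\<Sum>k<?n. (e k \<bullet> h (e j)) *\<^sub>R e k)"
      by (simp add: inner_sum_right mult.commute)
    also have "\<dots> = b i \<bullet> h (e j)"
      using orthonormal_basis_expand[OF e, of "h (e j)"] inv eW[OF ij(2)] by auto
    also have "h (e j) = (\<Sum>k<?n. (b k \<bullet> e j) *\<^sub>R h (b k))"
    proof -
      have "h (e j) = h (\<Sum>k<?n. (b k \<bullet> e j) *\<^sub>R b k)"
        using orthonormal_basis_expand[OF b eW[OF ij(2)]] by simp
      then show ?thesis using lin by (simp add: linear_sum linear_scale)
    qed
    also have "b i \<bullet> \<dots> = (matrix_wrt ?n b h * P) $$ (i, j)"
      using ij by (simp add: P_def matrix_wrt_def scalar_prod_def lessThan_atLeast0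
          inner_sum_right mult.commute)
    finally show "(P * matrix_wrt ?n e h) $$ (i, j) = (matrix_wrt ?n b h * P) $$ (i, j)" .
  qed (auto simp: P_def matrix_wrt_def)
  then have "Determinant.det P * Determinant.det (matrix_wrt ?n e h) =
      Determinant.det (matrix_wrt ?n b h) * Determinant.det P"
    using Determinant.det_mult[OF P M] Determinant.det_mult[OF M P] by metis
  moreover have "Determinant.det P \<noteq> 0"
  proof -
    have "Determinant.det (transpose_mat P) * Determinant.det P = 1"
      using Determinant.det_mult[of "transpose_mat P" ?n P] P PP by simp
    then show ?thesis by auto
  qed
  ultimately have "Determinant.det (matrix_wrt ?n e h) = Determinant.det (matrix_wrt ?n b h)"
    by (metis mult.commute mult_cancel_right)
  then show ?thesis unfolding det_on_def b_def by (rule sym)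
qed

text \<open>Maps in \<open>SO_D \<xi>\<close> preserve \<open>D \<xi>\<close>, being orthogonal and fixing \<open>\<xi>\<close>.\<close>

definition SO_D :: "'v::euclidean_space \<Rightarrow> ('v \<Rightarrow> 'v) set" where
  "SO_D \<xi> = {h. orthogonal_transformation h \<and> h \<xi> = \<xi> \<and> det_on (D \<xi>) h = 1}"

definition pullback :: "('v \<Rightarrow> 'v) \<Rightarrow> 'v::euclidean_space trilinear_form \<Rightarrow> 'v trilinear_form" where
  "pullback f S = Blinfun (\<lambda>X. Blinfun (\<lambda>Y. Blinfun (\<lambda>Z. S (f X) (f Y) (f Z))))"

lemma pullback_apply:
  fixes f :: "'v::euclidean_space \<Rightarrow> 'v"
  assumes "linear f"
  shows "pullback f S X Y Z = S (f X) (f Y) (f Z)"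
proof -
  have 1: "bounded_linear (\<lambda>Z. S (f X) (f Y) (f Z))" for X Y
    by (simp add: linear_conv_bounded_linear[symmetric] linear_iff blinfun.bilinear_simps
        linear_add[OF assms] linear_scale[OF assms])
  note apply1 = bounded_linear_Blinfun_apply[OF 1]
  have 2: "bounded_linear (\<lambda>Y. Blinfun (\<lambda>Z. S (f X) (f Y) (f Z)))" for X
    unfolding linear_conv_bounded_linear[symmetric]
    by (rule linearI; rule blinfun_eqI; simp only: blinfun.add_left blinfun.scaleR_left apply1;
        simp add: blinfun.bilinear_simps linear_add[OF assms] linear_scale[OF assms])
  note apply2 = bounded_linear_Blinfun_apply[OF 2]
  have 3: "bounded_linear (\<lambda>X. Blinfun (\<lambda>Y. Blinfun (\<lambda>Z. S (f X) (f Y) (f Z))))"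
    unfolding linear_conv_bounded_linear[symmetric]
    by (rule linearI; (rule blinfun_eqI)+;
        simp only: blinfun.add_left blinfun.scaleR_left apply2 apply1;
        simp add: blinfun.bilinear_simps linear_add[OF assms] linear_scale[OF assms])
  show ?thesis
    by (simp only: pullback_def bounded_linear_Blinfun_apply[OF 3] apply2 apply1)
qed

definition act :: "('v \<Rightarrow> 'v) \<Rightarrow> 'v::euclidean_space trilinear_form \<Rightarrow> 'v trilinear_form" where
  "act h S = pullback (inv_into UNIV h) S"

definition SO_submodule :: "'v::euclidean_space \<Rightarrow> 'v trilinear_form set \<Rightarrow> bool" where
  "SO_submodule \<xi> M \<longleftrightarrow> subspace M \<and> (\<forall>h\<in>SO_D \<xi>. \<forall>S\<in>M. act h S \<in> M)"

definition irreducible_SO_submodule :: "'v::euclidean_space \<Rightarrow> 'v trilinear_form set \<Rightarrow> bool" where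
  "irreducible_SO_submodule \<xi> M \<longleftrightarrow>
     SO_submodule \<xi> M \<and> M \<noteq> {0} \<and> (\<forall>N. SO_submodule \<xi> N \<and> N \<subseteq> M \<longrightarrow> N = {0} \<or> N = M)"

text \<open>\<open>D\<^sup>* \<otimes> U\<^sup>* \<otimes> D\<^sup>*\<close> inside \<open>V\<^sup>* \<otimes> V\<^sup>* \<otimes> V\<^sup>*\<close>: a form on \<open>D \<times> U \<times> D\<close> is extended by zero
  to the complementary summands of \<open>V = U \<oplus> D\<close>.\<close>

definition II :: "'v::euclidean_space \<Rightarrow> 'v trilinear_form set" where
  "II \<xi> = {S :: 'v trilinear_form. \<forall>X Y Z. X \<in> U \<xi> \<or> Y \<in> D \<xi> \<or> Z \<in> U \<xi> \<longrightarrow> S X Y Z = 0}"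

definition c13 :: "'v::euclidean_space \<Rightarrow> 'v trilinear_form \<Rightarrow> 'v \<Rightarrow> real" where
  "c13 \<xi> S Y = (\<Sum>i<dim (D \<xi>). S (some_onb (D \<xi>) i) Y (some_onb (D \<xi>) i))"

definition II1 :: "'v::euclidean_space \<Rightarrow> 'v trilinear_form set" where
  "II1 \<xi> = {S :: 'v trilinear_form. S \<in> II \<xi> \<and>
     (\<exists>l::real. \<forall>X\<in>D \<xi>. \<forall>Z\<in>D \<xi>. \<forall>Y. S X Y Z = l * (X \<bullet> Z) * (Y \<bullet> \<xi>))}"

definition II2 :: "'v::euclidean_space \<Rightarrow> 'v trilinear_form set" where
  "II2 \<xi> = {S :: 'v trilinear_form. S \<in> II \<xi> \<and>
     (\<forall>X\<in>D \<xi>. \<forall>Z\<in>D \<xi>. \<forall>Y. S X Y Z = (Y \<bullet> \<xi>) * S X \<xi> Z) \<and>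
     (\<forall>X\<in>D \<xi>. \<forall>Z\<in>D \<xi>. S X \<xi> Z = S Z \<xi> X) \<and>
     (\<forall>Y. c13 \<xi> S Y = 0)}"

text \<open>\<open>II3 \<xi>\<close> is isomorphic to \<open>\<Lambda>\<^sup>2 D\<^sup>*\<close>. For \<open>dim D = 4\<close> it is not irreducible under \<open>SO(4)\<close>: it splits
  into the self-dual and the anti-self-dual forms.\<close>

definition II3 :: "'v::euclidean_space \<Rightarrow> 'v trilinear_form set" where
  "II3 \<xi> = {S :: 'v trilinear_form. S \<in> II \<xi> \<and>
     (\<forall>X\<in>D \<xi>. \<forall>Z\<in>D \<xi>. \<forall>Y. S X Y Z = (Y \<bullet> \<xi>) * S X \<xi> Z) \<and>
     (\<forall>X\<in>D \<xi>. \<forall>Z\<in>D \<xi>. S X \<xi> Z = - S Z \<xi> X)}"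

end

theory Submission
  imports Defs
begin

text \<open>
  In an orthonormal basis \<open>e\<^sub>0, \<dots>, e\<^sub>n\<^sub>-\<^sub>1\<close> of \<open>D\<close>, a form \<open>S \<in> D\<^sup>* \<otimes> U\<^sup>* \<otimes> D\<^sup>*\<close> is the same thing as the
  \<open>n \<times> n\<close> matrix of coefficients \<open>S(e\<^sub>i, \<xi>, e\<^sub>j)\<close>, because \<open>\<xi>\<close> spans \<open>U\<close>. Under this identification the
  three submodules are the scalar, the traceless symmetric and the skew-symmetric matrices
  (\<open>mem_II1_iff\<close>, \<open>mem_II2_iff\<close>, \<open>mem_II3_iff\<close>), so the direct sum decomposition is the splitting of a
  matrix into these three parts. Invariance is seen without coordinates, from the fact that
  elements of \<open>SO(D)\<close> preserve \<open>g\<close>, \<open>\<xi>\<close> and \<open>D\<close> and carry orthonormal bases to orthonormal bases.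

  Irreducibility uses only rotations in coordinate planes. Starting from a nonzero element of a
  submodule \<open>N\<close>, linear combinations of its rotated copies isolate a single generator; moving
  its indices by quarter turns produces all generators of the module, so \<open>N\<close> is everything.

  For traceless symmetric matrices the isolating step works inside one plane \<open>(a, b)\<close>. With \<open>\<rho>\<close> the
  quarter turn, averaging over \<open>\<rho>\<^sup>2\<close> removes the entries linking the plane to its complement, and
  subtracting the image under \<open>\<rho>\<close> removes everything but the traceless part of the block
  (\<open>isolate_symmetric_block\<close>). On such blocks the rotation by 45 degrees acts as a quarter turn
  (\<open>eighth_turn\<close>), which yields the two generators separately.

  For skew-symmetric matrices the block in the plane \<open>(a, b)\<close> is invariant under \<open>\<rho>\<close>, and half turns have
  to be used instead. Antisymmetrising under the half turns of the planes \<open>(b, c)\<close> and \<open>(a, c)\<close>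
  keeps only the entries at \<open>{a, b}\<close> and at \<open>{c, x}\<close> with \<open>x\<close> outside \<open>{a, b, c}\<close>
  (\<open>isolate_mixed\<close>). For \<open>n = 3\<close> there is no such \<open>x\<close>; for \<open>n \<ge> 5\<close> three different choices of \<open>c\<close>
  leave \<open>{a, b}\<close> as the only common pair. For \<open>n = 4\<close> the pairs \<open>{a, b}\<close> and \<open>{c, x}\<close> are complementary
  and cannot be separated, in agreement with the splitting of two-forms into
  self-dual and anti-self-dual ones.
\<close>

text \<open>The dot always denotes the inner product below.\<close>

no_notation Matrix.scalar_prod (infix "\<bullet>" 70)

section \<open>Rotations as elements of the structure group\<close>

lemma mem_D_iff: "x \<in> D \<xi> \<longleftrightarrow> \<xi> \<bullet> x = 0"
proof
  assume "x \<in> D \<xi>"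
  then show "\<xi> \<bullet> x = 0"
    by (auto simp: D_def U_def orthogonal_comp_def orthogonal_def intro: span_base)
next
  assume "\<xi> \<bullet> x = 0"
  then show "x \<in> D \<xi>"
    by (auto simp: D_def U_def orthogonal_comp_def orthogonal_def span_singleton)
qed

lemma subspace_D: "subspace (D \<xi>)"
  by (simp add: D_def subspace_orthogonal_comp)

lemma dim_D:
  fixes \<xi> :: "'v::euclidean_space"
  assumes "\<xi> \<noteq> 0"
  shows "dim (D \<xi>) = DIM('v) - 1"
proof -
  have "D \<xi> = {x. \<xi> \<bullet> x = 0}" by (auto simp: mem_D_iff)
  then show ?thesis using dim_hyperplane[OF assms] by simp
qed

lemma orthogonal_image_D:
  assumes "orthogonal_transformation h" "h \<xi> = \<xi>"
  shows "h ` D \<xi> \<subseteq> D \<xi>"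
  using assms by (auto simp: mem_D_iff orthogonal_transformation_def) metis

text \<open>
  If \<open>M\<close> is the matrix of an orthogonal map, \<open>M\<^sup>T M = 1\<close> gives
  \<open>det (M\<^sup>2) = det (M\<^sup>T M) = 1\<close>. Since a rotation is the square of the rotation by half its angle,
  this puts all plane rotations into \<open>SO\<close> without any expansion of a determinant.
\<close>

lemma det_on_orthogonal_square:
  fixes W :: "'v::euclidean_space set"
  assumes W: "subspace W" and h: "orthogonal_transformation h" and inv: "h ` W \<subseteq> W"
  shows "det_on W (h \<circ> h) = 1"
proof -
  let ?n = "dim W"
  define e where "e = some_onb W"
  have e: "orthonormal_basis W e" unfolding e_def by (rule some_onb[OF W])
  have lin: "linear h" using h by (rule orthogonal_transformation_linear)
  have eW: "e i \<in> W" if "i < ?n" for i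
    using e that span_base[of "e i" "e ` {..<?n}"] by (auto simp: orthonormal_basis_def)
  define M where "M = matrix_wrt ?n e h"
  have M: "M \<in> carrier_mat ?n ?n" by (simp add: M_def matrix_wrt_def)
  have exp: "x \<bullet> y = (\<Sum>k<?n. (e k \<bullet> x) * (e k \<bullet> y))" if "x \<in> W" for x y
  proof -
    have "x \<bullet> y = (\<Sum>k<?n. (e k \<bullet> x) *\<^sub>R e k) \<bullet> y"
      using orthonormal_basis_expand[OF e that] by simp
    then show ?thesis by (simp add: inner_sum_left)
  qed
  have "transpose_mat M * M = 1\<^sub>m ?n"
  proof (rule eq_matI)
    fix i j assume "i < dim_row (1\<^sub>m ?n :: real Matrix.mat)" "j < dim_col (1\<^sub>m ?n :: real Matrix.mat)"
    then have ij: "i < ?n" "j < ?n" by auto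
    have "(transpose_mat M * M) $$ (i, j) = (\<Sum>k<?n. (e k \<bullet> h (e i)) * (e k \<bullet> h (e j)))"
      using ij by (simp add: M_def matrix_wrt_def scalar_prod_def lessThan_atLeast0)
    also have "\<dots> = h (e i) \<bullet> h (e j)" using exp[of "h (e i)"] eW[OF ij(1)] inv by auto
    also have "\<dots> = e i \<bullet> e j" using h by (simp add: orthogonal_transformation_def)
    finally show "(transpose_mat M * M) $$ (i, j) = 1\<^sub>m ?n $$ (i, j)"
      using e ij by (simp add: orthonormal_basis_def)
  qed (auto simp: M_def matrix_wrt_def)
  then have "Determinant.det M * Determinant.det M = 1"
    using Determinant.det_mult[of "transpose_mat M" ?n M] M Determinant.det_transpose[OF M] by simp
  moreover have "matrix_wrt ?n e (h \<circ> h) = M * M"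
  proof (rule eq_matI)
    fix i j assume "i < dim_row (M * M)" "j < dim_col (M * M)"
    then have ij: "i < ?n" "j < ?n" by (auto simp: M_def matrix_wrt_def)
    have "h (h (e j)) = h (\<Sum>k<?n. (e k \<bullet> h (e j)) *\<^sub>R e k)"
      using orthonormal_basis_expand[OF e, of "h (e j)"] inv eW[OF ij(2)] by auto
    also have "\<dots> = (\<Sum>k<?n. (e k \<bullet> h (e j)) *\<^sub>R h (e k))"
      using lin by (simp add: linear_sum linear_scale)
    finally show "matrix_wrt ?n e (h \<circ> h) $$ (i, j) = (M * M) $$ (i, j)"
      using ij by (simp add: M_def matrix_wrt_def scalar_prod_def lessThan_atLeast0
          inner_sum_right mult.commute)
  qed (auto simp: M_def matrix_wrt_def)
  ultimately show ?thesis
    using Determinant.det_mult[OF M M] by (simp add: det_on_def e_def[symmetric])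
qed

definition plane_rotation :: "'v::euclidean_space \<Rightarrow> 'v \<Rightarrow> real \<Rightarrow> 'v \<Rightarrow> 'v" where
  "plane_rotation a b t x = x + ((cos t - 1) * (a \<bullet> x) - sin t * (b \<bullet> x)) *\<^sub>R a
     + (sin t * (a \<bullet> x) + (cos t - 1) * (b \<bullet> x)) *\<^sub>R b"

context
  fixes a b :: "'v::euclidean_space"
  assumes ab: "a \<bullet> a = 1" "b \<bullet> b = 1" "a \<bullet> b = 0"
begin

lemma plane_rotation_first: "plane_rotation a b t a = cos t *\<^sub>R a + sin t *\<^sub>R b"
  using ab by (simp add: plane_rotation_def inner_commute algebra_simps)

lemma plane_rotation_second: "plane_rotation a b t b = cos t *\<^sub>R b - sin t *\<^sub>R a"
  using ab by (simp add: plane_rotation_def inner_commute algebra_simps)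

lemma plane_rotation_orthogonal_fixed: "a \<bullet> x = 0 \<Longrightarrow> b \<bullet> x = 0 \<Longrightarrow> plane_rotation a b t x = x"
  by (simp add: plane_rotation_def)

lemma linear_plane_rotation: "linear (plane_rotation a b t)"
  by (rule linearI) (simp_all add: plane_rotation_def inner_add_right algebra_simps)

lemma plane_rotation_add: "plane_rotation a b s (plane_rotation a b t x) = plane_rotation a b (s + t) x"
proof -
  have ia: "a \<bullet> plane_rotation a b t x = cos t * (a \<bullet> x) - sin t * (b \<bullet> x)"
    and ib: "b \<bullet> plane_rotation a b t x = sin t * (a \<bullet> x) + cos t * (b \<bullet> x)"
    using ab by (simp_all add: plane_rotation_def inner_add_right inner_commute algebra_simps)
  show ?thesis
    unfolding plane_rotation_def[of a b s "plane_rotation a b t x"] ia ib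
    by (simp add: plane_rotation_def cos_add sin_add algebra_simps)
qed

lemma plane_rotation_zero: "plane_rotation a b 0 x = x"
  by (simp add: plane_rotation_def)

text \<open>The rotation by \<open>-t\<close> is both the adjoint and the inverse of the rotation by \<open>t\<close>.\<close>

lemma inner_plane_rotation: "plane_rotation a b t x \<bullet> plane_rotation a b t y = x \<bullet> y"
proof -
  have adj: "plane_rotation a b t x \<bullet> z = x \<bullet> plane_rotation a b (- t) z" for z
    by (simp add: plane_rotation_def inner_add_left inner_add_right inner_commute algebra_simps)
  show ?thesis
    by (simp add: adj plane_rotation_add plane_rotation_zero)
qed

lemma orthogonal_plane_rotation: "orthogonal_transformation (plane_rotation a b t)"
  by (simp add: orthogonal_transformation_def linear_plane_rotation inner_plane_rotation)

lemma inv_plane_rotation: "inv_into UNIV (plane_rotation a b t) = plane_rotation a b (- t)"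
  by (rule inv_unique_comp) (simp_all add: fun_eq_iff plane_rotation_add plane_rotation_zero)

lemma plane_rotation_in_SO_D:
  assumes "a \<in> D \<xi>" "b \<in> D \<xi>"
  shows "plane_rotation a b t \<in> SO_D \<xi>"
proof -
  have fixes_xi: "plane_rotation a b s \<xi> = \<xi>" for s
    using assms by (simp add: plane_rotation_orthogonal_fixed mem_D_iff inner_commute)
  have "plane_rotation a b t = plane_rotation a b (t/2) \<circ> plane_rotation a b (t/2)"
    by (rule ext) (simp add: plane_rotation_add)
  then have "det_on (D \<xi>) (plane_rotation a b t) = 1"
    using det_on_orthogonal_square[OF subspace_D orthogonal_plane_rotation
        orthogonal_image_D[OF orthogonal_plane_rotation fixes_xi]] by metis
  then show ?thesis by (simp add: SO_D_def orthogonal_plane_rotation fixes_xi)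
qed

end

text \<open>
  The inverse in \<^const>\<open>act\<close> is absorbed by reversing the angle, so that from here on rotations can act
  by \<^const>\<open>pullback\<close>.
\<close>

lemma SO_submodule_plane_rotation:
  assumes "SO_submodule \<xi> N" "S \<in> N"
    and "a \<bullet> a = 1" "b \<bullet> b = 1" "a \<bullet> b = 0" "a \<in> D \<xi>" "b \<in> D \<xi>"
  shows "pullback (plane_rotation a b t) S \<in> N"
proof -
  have "act (plane_rotation a b (- t)) S \<in> N"
    using assms plane_rotation_in_SO_D[of a b \<xi> "- t"] by (auto simp: SO_submodule_def)
  then show ?thesis using assms by (simp add: act_def inv_plane_rotation)
qed

section \<open>Coefficients in an adapted orthonormal basis\<close>

definition tensor :: "'v::euclidean_space \<Rightarrow> 'v \<Rightarrow> 'v \<Rightarrow> 'v trilinear_form" where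
  "tensor u v w = Blinfun (\<lambda>X. (u \<bullet> X) *\<^sub>R Blinfun (\<lambda>Y. (v \<bullet> Y) *\<^sub>R Blinfun (\<lambda>Z. w \<bullet> Z)))"

lemma tensor_apply [simp]: "tensor u v w X Y Z = (u \<bullet> X) * (v \<bullet> Y) * (w \<bullet> Z)"
proof -
  have 1: "bounded_linear (\<lambda>Z. w \<bullet> Z)" by (rule bounded_linear_inner_right)
  have 2: "bounded_linear (\<lambda>Y. (v \<bullet> Y) *\<^sub>R B)" for v :: 'a and B :: "'b::real_normed_vector"
    by (intro bounded_linear_intros)
  show ?thesis
    by (simp add: tensor_def bounded_linear_Blinfun_apply[OF 2] bounded_linear_Blinfun_apply[OF 1]
        blinfun.scaleR_left)
qed

locale adapted_basis =
  fixes \<xi> :: "'v::euclidean_space" and n :: nat and e :: "nat \<Rightarrow> 'v"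
  assumes DIM: "DIM('v) = n + 1" and norm_xi: "norm \<xi> = 1" and onb: "orthonormal_basis (D \<xi>) e"
begin

lemma xi_nonzero: "\<xi> \<noteq> 0" using norm_xi by auto

lemma inner_xi [simp]: "\<xi> \<bullet> \<xi> = 1" using norm_xi by (simp add: norm_eq_1)

lemma dim_D_eq [simp]: "dim (D \<xi>) = n"
  using dim_D[OF xi_nonzero] DIM by simp

lemma inner_e: "i < n \<Longrightarrow> j < n \<Longrightarrow> e i \<bullet> e j = (if i = j then 1 else 0)"
  using onb by (simp add: orthonormal_basis_def)

lemma e_in_D: "i < n \<Longrightarrow> e i \<in> D \<xi>"
  using onb span_base[of "e i" "e ` {..<n}"] by (auto simp: orthonormal_basis_def)

lemma inner_xi_e [simp]: "i < n \<Longrightarrow> \<xi> \<bullet> e i = 0" "i < n \<Longrightarrow> e i \<bullet> \<xi> = 0"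
  using e_in_D[of i] by (simp_all add: mem_D_iff inner_commute)

lemma basis_expansion: "x = (\<xi> \<bullet> x) *\<^sub>R \<xi> + (\<Sum>i<n. (e i \<bullet> x) *\<^sub>R e i)"
proof -
  let ?y = "x - (\<xi> \<bullet> x) *\<^sub>R \<xi>"
  have "?y \<in> D \<xi>" by (simp add: mem_D_iff inner_diff_right)
  then have "?y = (\<Sum>i<n. (e i \<bullet> ?y) *\<^sub>R e i)"
    using orthonormal_basis_expand[OF onb] by simp
  also have "\<dots> = (\<Sum>i<n. (e i \<bullet> x) *\<^sub>R e i)"
    by (intro sum.cong) (simp_all add: inner_diff_right)
  finally show ?thesis by (simp add: algebra_simps)
qed

definition coeff :: "'v trilinear_form \<Rightarrow> nat \<Rightarrow> nat \<Rightarrow> real" where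
  "coeff S i j = S (e i) \<xi> (e j)"

text \<open>The matrix unit at position \<open>(i, j)\<close>.\<close>

definition E :: "nat \<Rightarrow> nat \<Rightarrow> 'v trilinear_form" where
  "E i j = tensor (e i) \<xi> (e j)"

lemma coeff_linear [simp]:
  "coeff (S + T) i j = coeff S i j + coeff T i j"
  "coeff (S - T) i j = coeff S i j - coeff T i j"
  "coeff (- S) i j = - coeff S i j"
  "coeff (r *\<^sub>R S) i j = r * coeff S i j"
  "coeff 0 i j = 0"
  by (simp_all add: coeff_def blinfun.bilinear_simps)

lemma coeff_sum: "coeff (\<Sum>k\<in>K. f k) i j = (\<Sum>k\<in>K. coeff (f k) i j)"
  by (simp add: coeff_def blinfun.sum_left)

lemma coeff_E: "i < n \<Longrightarrow> j < n \<Longrightarrow> k < n \<Longrightarrow> l < n \<Longrightarrow>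
    coeff (E i j) k l = (if i = k \<and> j = l then 1 else 0)"
  by (simp add: coeff_def E_def inner_e)

lemma U_multiple: "X \<in> U \<xi> \<Longrightarrow> \<exists>r. X = r *\<^sub>R \<xi>"
  by (auto simp: U_def span_singleton)

lemma mem_II_dest:
  assumes "S \<in> II \<xi>"
  shows "S \<xi> Y Z = 0" "S X Y \<xi> = 0" "\<xi> \<bullet> Y = 0 \<Longrightarrow> S X Y Z = 0"
proof -
  have "\<xi> \<in> U \<xi>" by (auto simp: U_def intro: span_base)
  then show "S \<xi> Y Z = 0" "S X Y \<xi> = 0" "\<xi> \<bullet> Y = 0 \<Longrightarrow> S X Y Z = 0"
    using assms by (auto simp: II_def mem_D_iff)
qed

lemma mem_II_intro:
  fixes S :: "'v trilinear_form"
  assumes "\<And>Y Z. S \<xi> Y Z = 0" "\<And>X Y. S X Y \<xi> = 0" "\<And>X Y Z. \<xi> \<bullet> Y = 0 \<Longrightarrow> S X Y Z = 0"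
  shows "S \<in> II \<xi>"
  using assms U_multiple by (fastforce simp: II_def mem_D_iff blinfun.bilinear_simps)

lemma subspace_II: "subspace (II \<xi>)"
  by (auto simp: subspace_def II_def blinfun.bilinear_simps)

lemma E_in_II: "i < n \<Longrightarrow> j < n \<Longrightarrow> E i j \<in> II \<xi>"
  by (rule mem_II_intro) (simp_all add: E_def)

lemma II_middle:
  assumes "S \<in> II \<xi>"
  shows "S X Y Z = (Y \<bullet> \<xi>) * S X \<xi> Z"
proof -
  have "S X (Y - (Y \<bullet> \<xi>) *\<^sub>R \<xi>) Z = 0"
    by (rule mem_II_dest(3)[OF assms]) (simp add: inner_diff_right inner_commute)
  then show ?thesis by (simp add: blinfun.bilinear_simps)
qed

lemma II_expansion:
  assumes "S \<in> II \<xi>"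
  shows "S X Y Z = (Y \<bullet> \<xi>) * (\<Sum>i<n. \<Sum>j<n. (e i \<bullet> X) * (e j \<bullet> Z) * coeff S i j)"
proof -
  have "S X \<xi> Z = S ((\<xi> \<bullet> X) *\<^sub>R \<xi> + (\<Sum>i<n. (e i \<bullet> X) *\<^sub>R e i)) \<xi>
      ((\<xi> \<bullet> Z) *\<^sub>R \<xi> + (\<Sum>j<n. (e j \<bullet> Z) *\<^sub>R e j))"
    using basis_expansion[of X] basis_expansion[of Z] by simp
  also have "\<dots> = (\<Sum>i<n. \<Sum>j<n. (e i \<bullet> X) * (e j \<bullet> Z) * coeff S i j)"
    using mem_II_dest(1,2)[OF assms]
    by (simp add: blinfun.bilinear_simps blinfun.sum_left blinfun.sum_right coeff_def
        sum_distrib_left mult.assoc; subst sum.swap; simp add: mult.left_commute)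
  finally show ?thesis using II_middle[OF assms, of X Y Z] by simp
qed

lemma II_eqI:
  assumes "S \<in> II \<xi>" "T \<in> II \<xi>" "\<And>i j. i < n \<Longrightarrow> j < n \<Longrightarrow> coeff S i j = coeff T i j"
  shows "S = T"
  by (intro blinfun_eqI) (simp add: II_expansion[OF assms(1)] II_expansion[OF assms(2)] assms(3))

lemma II_eq_sum_E:
  assumes "S \<in> II \<xi>"
  shows "S = (\<Sum>i<n. \<Sum>j<n. coeff S i j *\<^sub>R E i j)"
  by (intro blinfun_eqI)
    (simp add: II_expansion[OF assms] blinfun.sum_left blinfun.bilinear_simps E_def inner_commute
      sum_distrib_left ac_simps)

lemma form_with_coeff:
  obtains S where "S \<in> II \<xi>" "\<And>i j. i < n \<Longrightarrow> j < n \<Longrightarrow> coeff S i j = f i j"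
proof
  let ?S = "\<Sum>i<n. \<Sum>j<n. f i j *\<^sub>R E i j"
  show "?S \<in> II \<xi>"
    by (intro subspace_sum[OF subspace_II] subspace_scale[OF subspace_II] E_in_II) auto
  fix k l assume kl: "k < n" "l < n"
  have "coeff ?S k l = (\<Sum>i<n. \<Sum>j<n. if i = k \<and> j = l then f i j else 0)"
    unfolding coeff_sum using kl by (intro sum.cong refl) (simp add: coeff_E)
  also have "\<dots> = (\<Sum>i<n. if i = k then f i l else 0)"
    using kl by (intro sum.cong refl) (auto simp: if_distrib cong: if_cong)
  also have "\<dots> = f k l" using kl by simp
  finally show "coeff ?S k l = f k l" .
qed

lemma parseval:
  assumes "orthonormal_basis (D \<xi>) f" "x \<in> D \<xi>"
  shows "x \<bullet> y = (\<Sum>i<n. (f i \<bullet> x) * (f i \<bullet> y))"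
proof -
  have "x \<bullet> y = (\<Sum>i<n. (f i \<bullet> x) *\<^sub>R f i) \<bullet> y"
    using orthonormal_basis_expand[OF assms] by simp
  then show ?thesis by (simp add: inner_sum_left)
qed

text \<open>
  The trace of a bilinear form in an orthonormal basis \<open>f\<close> is independent of \<open>f\<close>: expanding in \<open>e\<close>, the
  sum over \<open>f\<close> collapses to \<open>e\<^sub>k \<bullet> e\<^sub>l\<close> by Parseval's identity for \<open>f\<close>.
\<close>

lemma trace_any_basis:
  assumes S: "S \<in> II \<xi>" and f: "orthonormal_basis (D \<xi>) f"
  shows "(\<Sum>i<n. S (f i) Y (f i)) = (Y \<bullet> \<xi>) * (\<Sum>k<n. coeff S k k)"
proof -
  have "(\<Sum>i<n. S (f i) Y (f i)) =
      (Y \<bullet> \<xi>) * (\<Sum>i<n. \<Sum>k<n. \<Sum>l<n. (e k \<bullet> f i) * (e l \<bullet> f i) * coeff S k l)"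
    by (simp add: II_expansion[OF S] sum_distrib_left)
  also have "(\<Sum>i<n. \<Sum>k<n. \<Sum>l<n. (e k \<bullet> f i) * (e l \<bullet> f i) * coeff S k l) =
      (\<Sum>k<n. \<Sum>l<n. \<Sum>i<n. (e k \<bullet> f i) * (e l \<bullet> f i) * coeff S k l)"
    by (subst sum.swap, rule sum.cong[OF refl], rule sum.swap)
  also have "\<dots> = (\<Sum>k<n. \<Sum>l<n. (e k \<bullet> e l) * coeff S k l)"
    by (intro sum.cong refl)
      (simp add: parseval[OF f e_in_D] sum_distrib_right inner_commute)
  also have "\<dots> = (\<Sum>k<n. coeff S k k)"
    by (intro sum.cong refl) (simp add: inner_e if_distrib[of "\<lambda>x. x * _"] cong: if_cong)
  finally show ?thesis .
qed

lemma c13_eq_trace: "S \<in> II \<xi> \<Longrightarrow> c13 \<xi> S Y = (Y \<bullet> \<xi>) * (\<Sum>k<n. coeff S k k)"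
  using trace_any_basis[of S "some_onb (D \<xi>)"] some_onb[OF subspace_D[of \<xi>]] by (simp add: c13_def)

lemma c13_eq_sum:
  assumes "S \<in> II \<xi>" "orthonormal_basis (D \<xi>) f"
  shows "c13 \<xi> S Y = (\<Sum>i<n. S (f i) Y (f i))"
  by (simp add: c13_eq_trace trace_any_basis assms)

lemma mem_II1_iff:
  "S \<in> II1 \<xi> \<longleftrightarrow> S \<in> II \<xi> \<and> (\<exists>l. \<forall>i<n. \<forall>j<n. coeff S i j = (if i = j then l else 0))"
  (is "_ \<longleftrightarrow> _ \<and> (\<exists>l. ?A l)")
proof safe
  assume "S \<in> II1 \<xi>"
  then obtain l where *: "S \<in> II \<xi>"
    "\<And>X Y Z. X \<in> D \<xi> \<Longrightarrow> Z \<in> D \<xi> \<Longrightarrow> S X Y Z = l * (X \<bullet> Z) * (Y \<bullet> \<xi>)"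
    unfolding II1_def by blast
  show "S \<in> II \<xi>" by fact
  show "\<exists>l. ?A l"
    by (rule exI[of _ l]) (simp add: coeff_def * e_in_D inner_e)
next
  fix l assume S: "S \<in> II \<xi>" and l: "?A l"
  have "S X Y Z = l * (X \<bullet> Z) * (Y \<bullet> \<xi>)" if "X \<in> D \<xi>" for X Y Z
  proof -
    have "(\<Sum>i<n. \<Sum>j<n. (e i \<bullet> X) * (e j \<bullet> Z) * coeff S i j) = (\<Sum>i<n. (e i \<bullet> X) * (e i \<bullet> Z) * l)"
      by (intro sum.cong refl) (simp add: l if_distrib cong: if_cong)
    also have "\<dots> = l * (X \<bullet> Z)"
      by (simp add: parseval[OF onb that] sum_distrib_left ac_simps)
    finally show ?thesis using II_expansion[OF S, of X Y Z] by simp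
  qed
  with S show "S \<in> II1 \<xi>" by (auto simp: II1_def)
qed

lemma mem_II2_iff:
  "S \<in> II2 \<xi> \<longleftrightarrow> S \<in> II \<xi> \<and> (\<forall>i<n. \<forall>j<n. coeff S i j = coeff S j i) \<and> (\<Sum>i<n. coeff S i i) = 0"
proof (intro iffI conjI)
  assume *: "S \<in> II2 \<xi>"
  then show "S \<in> II \<xi>" by (simp add: II2_def)
  show "\<forall>i<n. \<forall>j<n. coeff S i j = coeff S j i" using * e_in_D unfolding II2_def coeff_def by blast
  have "c13 \<xi> S \<xi> = 0" using * by (simp add: II2_def)
  then show "(\<Sum>i<n. coeff S i i) = 0" using c13_eq_trace[OF \<open>S \<in> II \<xi>\<close>] by simp
next
  assume *: "S \<in> II \<xi> \<and> (\<forall>i<n. \<forall>j<n. coeff S i j = coeff S j i) \<and> (\<Sum>i<n. coeff S i i) = 0"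
  have "S X \<xi> Z = S Z \<xi> X" for X Z
  proof -
    have "(\<Sum>i<n. \<Sum>j<n. (e i \<bullet> X) * (e j \<bullet> Z) * coeff S i j) =
        (\<Sum>i<n. \<Sum>j<n. (e i \<bullet> Z) * (e j \<bullet> X) * coeff S i j)"
      using * by (subst sum.swap) (auto intro!: sum.cong)
    then show ?thesis using * II_expansion[of S _ \<xi>] by simp
  qed
  moreover have "c13 \<xi> S Y = 0" for Y using * by (simp add: c13_eq_trace)
  ultimately show "S \<in> II2 \<xi>" unfolding II2_def using * II_middle[of S] by blast
qed

lemma mem_II3_iff:
  "S \<in> II3 \<xi> \<longleftrightarrow> S \<in> II \<xi> \<and> (\<forall>i<n. \<forall>j<n. coeff S i j = - coeff S j i)"
proof (intro iffI conjI)
  assume *: "S \<in> II3 \<xi>"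
  then show "S \<in> II \<xi>" by (simp add: II3_def)
  show "\<forall>i<n. \<forall>j<n. coeff S i j = - coeff S j i" using * e_in_D unfolding II3_def coeff_def by blast
next
  assume *: "S \<in> II \<xi> \<and> (\<forall>i<n. \<forall>j<n. coeff S i j = - coeff S j i)"
  have "S X \<xi> Z = - S Z \<xi> X" for X Z
  proof -
    have "(\<Sum>i<n. \<Sum>j<n. (e i \<bullet> X) * (e j \<bullet> Z) * coeff S i j) =
        (\<Sum>i<n. \<Sum>j<n. (e i \<bullet> Z) * (e j \<bullet> X) * (- coeff S i j))"
    proof (subst sum.swap, intro sum.cong refl)
      fix i j assume "i \<in> {..<n}" "j \<in> {..<n}"
      then have "coeff S j i = - coeff S i j" using * by blast
      then show "(e j \<bullet> X) * (e i \<bullet> Z) * coeff S j i = (e i \<bullet> Z) * (e j \<bullet> X) * (- coeff S i j)"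
        by simp
    qed
    then show ?thesis using II_expansion[OF conjunct1[OF *], of _ \<xi>] by (simp add: sum_negf)
  qed
  then show "S \<in> II3 \<xi>" unfolding II3_def using * II_middle[of S] by blast
qed

section \<open>The decomposition into submodules\<close>

text \<open>
  Invariance is checked for the group of all orthogonal maps fixing \<open>\<xi>\<close>, which contains \<open>SO(D)\<close> and is
  visibly closed under the inverse that occurs in \<^const>\<open>act\<close>.
\<close>

lemma SO_submoduleI:
  assumes "subspace M"
    and "\<And>g S. orthogonal_transformation g \<Longrightarrow> g \<xi> = \<xi> \<Longrightarrow> S \<in> M \<Longrightarrow> pullback g S \<in> M"
  shows "SO_submodule \<xi> M"
proof -
  have "act h S \<in> M" if h: "h \<in> SO_D \<xi>" and S: "S \<in> M" for h S
  proof -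
    have o: "orthogonal_transformation h" "h \<xi> = \<xi>" using h by (auto simp: SO_D_def)
    have "orthogonal_transformation (inv_into UNIV h)"
      using o by (simp add: orthogonal_transformation_inv)
    moreover have "inv_into UNIV h \<xi> = \<xi>"
      using o orthogonal_transformation_inj[OF o(1)] by (metis inv_f_f)
    ultimately show ?thesis using assms(2) S by (simp add: act_def)
  qed
  then show ?thesis using assms(1) by (simp add: SO_submodule_def)
qed

context
  fixes g :: "'v \<Rightarrow> 'v"
  assumes g: "orthogonal_transformation g" and g_xi: "g \<xi> = \<xi>"
begin

lemma pullback_g: "pullback g S X Y Z = S (g X) (g Y) (g Z)"
  by (rule pullback_apply) (rule orthogonal_transformation_linear[OF g])

lemma g_inner: "g x \<bullet> g y = x \<bullet> y"
  using g by (simp add: orthogonal_transformation_def)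

lemma g_inner_xi: "g x \<bullet> \<xi> = x \<bullet> \<xi>"
  using g_inner[of x \<xi>] by (simp add: g_xi)

lemma g_D: "x \<in> D \<xi> \<Longrightarrow> g x \<in> D \<xi>"
  using orthogonal_image_D[OF g g_xi] by auto

lemma g_image_D: "g ` D \<xi> = D \<xi>"
proof
  show "g ` D \<xi> \<subseteq> D \<xi>" by (rule orthogonal_image_D[OF g g_xi])
  show "D \<xi> \<subseteq> g ` D \<xi>"
  proof
    fix x assume x: "x \<in> D \<xi>"
    obtain y where y: "x = g y" using orthogonal_transformation_surj[OF g] by (meson surjD)
    with x have "y \<in> D \<xi>" using g_inner_xi[of y] by (simp add: mem_D_iff inner_commute)
    with y show "x \<in> g ` D \<xi>" by blast
  qed
qed

lemma orthonormal_basis_g: "orthonormal_basis (D \<xi>) (g \<circ> e)"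
proof -
  have "span ((g \<circ> e) ` {..<n}) = g ` span (e ` {..<n})"
    using span_linear_image[OF orthogonal_transformation_linear[OF g], of "e ` {..<n}"]
    by (simp add: image_comp)
  also have "\<dots> = D \<xi>" using onb g_image_D by (simp add: orthonormal_basis_def)
  finally show ?thesis by (simp add: orthonormal_basis_def g_inner inner_e)
qed

lemma pullback_II: "S \<in> II \<xi> \<Longrightarrow> pullback g S \<in> II \<xi>"
  using g_inner_xi by (intro mem_II_intro) (simp_all add: pullback_g g_xi mem_II_dest inner_commute)

lemma pullback_II1: "S \<in> II1 \<xi> \<Longrightarrow> pullback g S \<in> II1 \<xi>"
  unfolding II1_def using pullback_II by (auto simp: pullback_g g_D g_inner g_inner_xi)

text \<open>
  The trace of the pulled back form in the basis \<open>e\<close> is the trace of \<open>S\<close> in the basis \<open>g \<circ> e\<close>.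
\<close>

lemma pullback_II2:
  assumes S: "S \<in> II2 \<xi>"
  shows "pullback g S \<in> II2 \<xi>"
proof -
  have II: "S \<in> II \<xi>" using S by (simp add: II2_def)
  have "c13 \<xi> (pullback g S) Y = c13 \<xi> S (g Y)" for Y
    using c13_eq_sum[OF II orthonormal_basis_g] c13_eq_sum[OF pullback_II[OF II] onb]
    by (simp add: pullback_g)
  then have "c13 \<xi> (pullback g S) Y = 0" for Y
    using S by (simp add: II2_def)
  moreover have "pullback g S X \<xi> Z = pullback g S Z \<xi> X" if "X \<in> D \<xi>" "Z \<in> D \<xi>" for X Z
    using S g_D[OF that(1)] g_D[OF that(2)] unfolding II2_def pullback_g g_xi by blast
  ultimately show ?thesis
    unfolding II2_def using pullback_II[OF II] II_middle[OF pullback_II[OF II]] by blast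
qed

lemma pullback_II3:
  assumes S: "S \<in> II3 \<xi>"
  shows "pullback g S \<in> II3 \<xi>"
proof -
  have II: "S \<in> II \<xi>" using S by (simp add: II3_def)
  have "pullback g S X \<xi> Z = - pullback g S Z \<xi> X" if "X \<in> D \<xi>" "Z \<in> D \<xi>" for X Z
    using S g_D[OF that(1)] g_D[OF that(2)] unfolding II3_def pullback_g g_xi by blast
  then show ?thesis
    unfolding II3_def using pullback_II[OF II] II_middle[OF pullback_II[OF II]] by blast
qed

end

lemma subspace_II1: "subspace (II1 \<xi>)"
proof (rule subspaceI)
  show "0 \<in> II1 \<xi>" by (auto simp: mem_II1_iff subspace_0[OF subspace_II])
  show "x + y \<in> II1 \<xi>" if xy: "x \<in> II1 \<xi>" "y \<in> II1 \<xi>" for x y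
  proof -
    obtain l m where "\<forall>i<n. \<forall>j<n. coeff x i j = (if i = j then l else 0)"
      "\<forall>i<n. \<forall>j<n. coeff y i j = (if i = j then m else 0)"
      using xy by (auto simp: mem_II1_iff)
    then have "\<forall>i<n. \<forall>j<n. coeff (x + y) i j = (if i = j then l + m else 0)" by simp
    then show ?thesis using xy subspace_add[OF subspace_II] unfolding mem_II1_iff by blast
  qed
  show "r *\<^sub>R x \<in> II1 \<xi>" if x: "x \<in> II1 \<xi>" for r x
  proof -
    obtain l where "\<forall>i<n. \<forall>j<n. coeff x i j = (if i = j then l else 0)"
      using x by (auto simp: mem_II1_iff)
    then have "\<forall>i<n. \<forall>j<n. coeff (r *\<^sub>R x) i j = (if i = j then r * l else 0)" by simp
    then show ?thesis using x subspace_scale[OF subspace_II] unfolding mem_II1_iff by blast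
  qed
qed

lemma subspace_II2: "subspace (II2 \<xi>)"
  using subspace_II
  by (auto simp: subspace_def mem_II2_iff sum.distrib simp flip: sum_distrib_left)

lemma subspace_II3: "subspace (II3 \<xi>)"
proof (rule subspaceI)
  show "0 \<in> II3 \<xi>" by (simp add: mem_II3_iff subspace_0[OF subspace_II])
  show "x + y \<in> II3 \<xi>" if xy: "x \<in> II3 \<xi>" "y \<in> II3 \<xi>" for x y
  proof -
    have "coeff (x + y) i j = - coeff (x + y) j i" if "i < n" "j < n" for i j
    proof -
      have "coeff x i j = - coeff x j i" "coeff y i j = - coeff y j i"
        using xy that unfolding mem_II3_iff by blast+
      then show ?thesis by simp
    qed
    then show ?thesis using xy subspace_add[OF subspace_II] unfolding mem_II3_iff by blast
  qed
  show "r *\<^sub>R x \<in> II3 \<xi>" if x: "x \<in> II3 \<xi>" for r x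
  proof -
    have "coeff (r *\<^sub>R x) i j = - coeff (r *\<^sub>R x) j i" if "i < n" "j < n" for i j
    proof -
      have "coeff x i j = - coeff x j i" using x that unfolding mem_II3_iff by blast
      then show ?thesis by simp
    qed
    then show ?thesis using x subspace_scale[OF subspace_II] unfolding mem_II3_iff by blast
  qed
qed

lemma SO_submodule_II: "SO_submodule \<xi> (II \<xi>)"
  by (rule SO_submoduleI[OF subspace_II pullback_II])

lemma SO_submodule_II1: "SO_submodule \<xi> (II1 \<xi>)"
  by (rule SO_submoduleI[OF subspace_II1 pullback_II1])

lemma SO_submodule_II2: "SO_submodule \<xi> (II2 \<xi>)"
  by (rule SO_submoduleI[OF subspace_II2 pullback_II2])

lemma SO_submodule_II3: "SO_submodule \<xi> (II3 \<xi>)"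
  by (rule SO_submoduleI[OF subspace_II3 pullback_II3])

text \<open>
  A vanishing sum of the three parts has vanishing skew part, and then vanishing trace, which leaves
  no scalar part either.
\<close>

lemma sum_parts_inj:
  assumes S: "S1 \<in> II1 \<xi>" "S2 \<in> II2 \<xi>" "S3 \<in> II3 \<xi>"
    and T: "T1 \<in> II1 \<xi>" "T2 \<in> II2 \<xi>" "T3 \<in> II3 \<xi>"
    and eq: "S1 + S2 + S3 = T1 + T2 + T3"
  shows "S1 = T1 \<and> S2 = T2 \<and> S3 = T3"
proof -
  define A1 A2 A3 where "A1 = S1 - T1" and "A2 = S2 - T2" and "A3 = S3 - T3"
  have mem: "A1 \<in> II1 \<xi>" "A2 \<in> II2 \<xi>" "A3 \<in> II3 \<xi>"
    unfolding A1_def A2_def A3_def using S T subspace_diff subspace_II1 subspace_II2 subspace_II3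
    by blast+
  have II: "A1 \<in> II \<xi>" "A3 \<in> II \<xi>"
    using mem by (simp_all add: mem_II1_iff mem_II3_iff)
  have zero: "A1 + A2 + A3 = 0" unfolding A1_def A2_def A3_def using eq by (simp add: algebra_simps)
  then have cz: "coeff A1 i j + coeff A2 i j + coeff A3 i j = 0" for i j
    by (metis coeff_linear(1,5))
  obtain l where l: "\<And>i j. i < n \<Longrightarrow> j < n \<Longrightarrow> coeff A1 i j = (if i = j then l else 0)"
    using mem(1) by (auto simp: mem_II1_iff)
  have sym2: "\<And>i j. i < n \<Longrightarrow> j < n \<Longrightarrow> coeff A2 i j = coeff A2 j i" and tr2: "(\<Sum>i<n. coeff A2 i i) = 0"
    using mem(2) by (auto simp: mem_II2_iff)
  have anti3: "\<And>i j. i < n \<Longrightarrow> j < n \<Longrightarrow> coeff A3 i j = - coeff A3 j i"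
    using mem(3) unfolding mem_II3_iff by blast
  have "coeff A3 i j = 0" if "i < n" "j < n" for i j
    using cz[of i j] cz[of j i] l[OF that] l[OF that(2,1)] sym2[OF that] anti3[OF that]
    by (auto split: if_splits)
  then have A3: "A3 = 0"
    using II_eqI[OF II(2) subspace_0[OF subspace_II]] by simp
  have "(\<Sum>i<n. coeff A1 i i + coeff A2 i i) = 0"
    using cz A3 by simp
  then have "real n * l = 0" using tr2 l by (simp add: sum.distrib)
  then have "coeff A1 i j = 0" if "i < n" "j < n" for i j
    using l[OF that] that by auto
  then have A1: "A1 = 0"
    using II_eqI[OF II(1) subspace_0[OF subspace_II]] by simp
  show ?thesis using A1 A3 zero by (simp add: A1_def A2_def A3_def)
qed

lemma sum_parts_surj:
  assumes S: "S \<in> II \<xi>"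
  obtains S1 S2 S3 where "S1 \<in> II1 \<xi>" "S2 \<in> II2 \<xi>" "S3 \<in> II3 \<xi>" "S = S1 + S2 + S3"
proof -
  \<comment> \<open>For \<open>n = 0\<close> the quotient is \<open>0\<close>, and the relation to the trace survives.\<close>
  define l where "l = (\<Sum>i<n. coeff S i i) / real n"
  have l: "real n * l = (\<Sum>i<n. coeff S i i)" by (cases "n = 0") (simp_all add: l_def)
  obtain S1 where S1: "S1 \<in> II \<xi>" "\<And>i j. i < n \<Longrightarrow> j < n \<Longrightarrow> coeff S1 i j = (if i = j then l else 0)"
    by (rule form_with_coeff[of "\<lambda>i j. if i = j then l else 0"]) blast
  obtain S2 where S2: "S2 \<in> II \<xi>" "\<And>i j. i < n \<Longrightarrow> j < n \<Longrightarrow>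
      coeff S2 i j = (coeff S i j + coeff S j i) / 2 - (if i = j then l else 0)"
    by (rule form_with_coeff[of "\<lambda>i j. (coeff S i j + coeff S j i) / 2 - (if i = j then l else 0)"]) blast
  obtain S3 where S3: "S3 \<in> II \<xi>" "\<And>i j. i < n \<Longrightarrow> j < n \<Longrightarrow>
      coeff S3 i j = (coeff S i j - coeff S j i) / 2"
    by (rule form_with_coeff[of "\<lambda>i j. (coeff S i j - coeff S j i) / 2"]) blast
  have "S1 \<in> II1 \<xi>" using S1 by (auto simp: mem_II1_iff)
  moreover have "S2 \<in> II2 \<xi>"
    using S2 l by (auto simp: mem_II2_iff sum_subtractf)
  moreover have "S3 \<in> II3 \<xi>"
  proof -
    have "coeff S3 i j = - coeff S3 j i" if "i < n" "j < n" for i j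
      unfolding S3(2)[OF that] S3(2)[OF that(2,1)] by (simp add: minus_divide_left)
    with S3(1) show ?thesis unfolding mem_II3_iff by blast
  qed
  moreover have "S = S1 + S2 + S3"
    by (rule II_eqI[OF S])
      (auto simp: S1 S2 S3 field_simps intro!: subspace_add[OF subspace_II])
  ultimately show ?thesis using that by blast
qed

lemma bij_betw_sum_parts:
  "bij_betw (\<lambda>(S1, S2, S3). S1 + S2 + S3) (II1 \<xi> \<times> II2 \<xi> \<times> II3 \<xi>) (II \<xi>)"
proof (rule bij_betw_imageI)
  show "inj_on (\<lambda>(S1, S2, S3). S1 + S2 + S3) (II1 \<xi> \<times> II2 \<xi> \<times> II3 \<xi>)"
    by (rule inj_onI) (use sum_parts_inj in fastforce)
  have "S1 + S2 + S3 \<in> II \<xi>" if "S1 \<in> II1 \<xi>" "S2 \<in> II2 \<xi>" "S3 \<in> II3 \<xi>" for S1 S2 S3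
    using that by (auto simp: mem_II1_iff mem_II2_iff mem_II3_iff intro!: subspace_add[OF subspace_II])
  moreover have "S \<in> (\<lambda>(S1, S2, S3). S1 + S2 + S3) ` (II1 \<xi> \<times> II2 \<xi> \<times> II3 \<xi>)" if "S \<in> II \<xi>" for S
    using sum_parts_surj[OF that] by (metis (mono_tags, lifting) SigmaI case_prod_conv image_eqI)
  ultimately show "(\<lambda>(S1, S2, S3). S1 + S2 + S3) ` (II1 \<xi> \<times> II2 \<xi> \<times> II3 \<xi>) = II \<xi>"
    by auto
qed

section \<open>Irreducibility\<close>

lemma irreducible_SO_submoduleI:
  assumes M: "SO_submodule \<xi> M" and T: "T \<in> M" "T \<noteq> 0"
    and gen: "\<And>N S. SO_submodule \<xi> N \<Longrightarrow> N \<subseteq> M \<Longrightarrow> S \<in> N \<Longrightarrow> S \<noteq> 0 \<Longrightarrow> M \<subseteq> N"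
  shows "irreducible_SO_submodule \<xi> M"
proof -
  have "N = {0} \<or> N = M" if "SO_submodule \<xi> N" "N \<subseteq> M" for N
  proof (cases "\<exists>S\<in>N. S \<noteq> 0")
    case True
    then show ?thesis using gen[OF that] that by blast
  next
    case False
    moreover have "0 \<in> N" using that(1) by (simp add: SO_submodule_def subspace_0)
    ultimately show ?thesis by blast
  qed
  then show ?thesis using M T by (auto simp: irreducible_SO_submodule_def)
qed

text \<open>The module of scalar matrices is one-dimensional.\<close>

lemma irreducible_II1:
  assumes "n \<ge> 1"
  shows "irreducible_SO_submodule \<xi> (II1 \<xi>)"
proof -
  obtain G where G: "G \<in> II \<xi>" "\<And>i j. i < n \<Longrightarrow> j < n \<Longrightarrow> coeff G i j = (if i = j then 1 else 0)"
    by (rule form_with_coeff[of "\<lambda>i j. if i = j then 1 else 0"]) blast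
  have multiple: "\<exists>l. S = l *\<^sub>R G" if S: "S \<in> II1 \<xi>" for S
  proof -
    obtain l where l: "S \<in> II \<xi>" "\<And>i j. i < n \<Longrightarrow> j < n \<Longrightarrow> coeff S i j = (if i = j then l else 0)"
      using S by (auto simp: mem_II1_iff)
    have "S = l *\<^sub>R G"
      by (rule II_eqI[OF l(1) subspace_scale[OF subspace_II G(1)]]) (simp add: l G)
    then show ?thesis ..
  qed
  show ?thesis
  proof (rule irreducible_SO_submoduleI[OF SO_submodule_II1])
    show "G \<in> II1 \<xi>" using G by (auto simp: mem_II1_iff)
    have "coeff G 0 0 = 1" using G(2)[of 0 0] assms by simp
    then show "G \<noteq> 0" by auto
    fix N S assume N: "SO_submodule \<xi> N" "N \<subseteq> II1 \<xi>" and S: "S \<in> N" "S \<noteq> 0"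
    have sub: "subspace N" using N(1) by (simp add: SO_submodule_def)
    obtain l where l: "S = l *\<^sub>R G" using multiple N(2) S(1) by blast
    then have "l \<noteq> 0" using S(2) by auto
    then have "G \<in> N" using subspace_scale[OF sub S(1), of "1 / l"] l by simp
    then show "II1 \<xi> \<subseteq> N" using multiple subspace_scale[OF sub] by blast
  qed
qed

definition turn :: "nat \<Rightarrow> nat \<Rightarrow> real \<Rightarrow> 'v trilinear_form \<Rightarrow> 'v trilinear_form" where
  "turn a b t = pullback (plane_rotation (e a) (e b) t)"

lemma turn_in_submodule:
  assumes "SO_submodule \<xi> N" "S \<in> N" "a < n" "b < n" "a \<noteq> b"
  shows "turn a b t S \<in> N"
  unfolding turn_def using assms e_in_D[OF assms(3)] e_in_D[OF assms(4)]
  by (intro SO_submodule_plane_rotation) (simp_all add: inner_e)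

lemma turn_in_II: "S \<in> II \<xi> \<Longrightarrow> a < n \<Longrightarrow> b < n \<Longrightarrow> a \<noteq> b \<Longrightarrow> turn a b t S \<in> II \<xi>"
  by (rule turn_in_submodule[OF SO_submodule_II])

lemma coeff_turn:
  assumes "a < n" "b < n" "a \<noteq> b" "k < n" "l < n"
  shows "coeff (turn a b t S) k l =
    S (if k = a then cos t *\<^sub>R e a + sin t *\<^sub>R e b else if k = b then cos t *\<^sub>R e b - sin t *\<^sub>R e a else e k)
      \<xi> (if l = a then cos t *\<^sub>R e a + sin t *\<^sub>R e b else if l = b then cos t *\<^sub>R e b - sin t *\<^sub>R e a else e l)"
proof -
  have ab: "e a \<bullet> e a = 1" "e b \<bullet> e b = 1" "e a \<bullet> e b = 0" using assms by (simp_all add: inner_e)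
  have rot: "plane_rotation (e a) (e b) t (e m) = (if m = a then cos t *\<^sub>R e a + sin t *\<^sub>R e b
      else if m = b then cos t *\<^sub>R e b - sin t *\<^sub>R e a else e m)" if "m < n" for m
    using assms that by (simp add: plane_rotation_first[OF ab] plane_rotation_second[OF ab]
        plane_rotation_orthogonal_fixed[OF ab] inner_e)
  have "plane_rotation (e a) (e b) t \<xi> = \<xi>"
    using assms by (simp add: plane_rotation_orthogonal_fixed[OF ab])
  then show ?thesis
    using assms by (simp add: turn_def coeff_def pullback_apply linear_plane_rotation[OF ab] rot)
qed

text \<open>A half turn changes the sign of \<open>e\<^sub>a\<close> and \<open>e\<^sub>b\<close> and fixes the other basis vectors.\<close>

lemma coeff_half_turn:
  assumes "a < n" "b < n" "a \<noteq> b" "k < n" "l < n"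
  shows "coeff (turn a b pi S) k l = (if k \<in> {a, b} \<longleftrightarrow> l \<in> {a, b} then coeff S k l else - coeff S k l)"
  unfolding coeff_turn[OF assms] using assms(3) by (auto simp: coeff_def blinfun.bilinear_simps)

text \<open>A quarter turn exchanges \<open>e\<^sub>a\<close> and \<open>e\<^sub>b\<close> up to a sign, which is carried by the image of \<open>e\<^sub>b\<close>.\<close>

lemma coeff_quarter_turn:
  assumes "a < n" "b < n" "a \<noteq> b" "k < n" "l < n"
  shows "coeff (turn a b (pi/2) S) k l =
    (if k = b then -1 else 1) * (if l = b then -1 else 1) *
    coeff S (if k = a then b else if k = b then a else k) (if l = a then b else if l = b then a else l)"
  unfolding coeff_turn[OF assms] using assms(3) by (auto simp: coeff_def blinfun.bilinear_simps)

text \<open>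
  Generators: \<open>sigma\<close> and \<open>delta\<close> span the traceless symmetric blocks of a coordinate plane,
  and \<open>omega i j\<close> is the two-form \<open>e\<^sub>i \<and> e\<^sub>j\<close>.
\<close>

definition sigma :: "nat \<Rightarrow> nat \<Rightarrow> 'v trilinear_form" where
  "sigma i j = E i j + E j i"

definition delta :: "nat \<Rightarrow> nat \<Rightarrow> 'v trilinear_form" where
  "delta i j = E i i - E j j"

definition omega :: "nat \<Rightarrow> nat \<Rightarrow> 'v trilinear_form" where
  "omega i j = E i j - E j i"

lemma generators_in_II:
  assumes "i < n" "j < n"
  shows "sigma i j \<in> II \<xi>" "delta i j \<in> II \<xi>" "omega i j \<in> II \<xi>"
  using assms by (simp_all add: sigma_def delta_def omega_def E_in_II subspace_add[OF subspace_II]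
      subspace_diff[OF subspace_II])

lemma coeff_generators:
  assumes "i < n" "j < n" "k < n" "l < n"
  shows "coeff (sigma i j) k l = (if i = k \<and> j = l then 1 else 0) + (if j = k \<and> i = l then 1 else 0)"
    "coeff (delta i j) k l = (if i = k \<and> i = l then 1 else 0) - (if j = k \<and> j = l then 1 else 0)"
    "coeff (omega i j) k l = (if i = k \<and> j = l then 1 else 0) - (if j = k \<and> i = l then 1 else 0)"
  using assms by (simp_all add: sigma_def delta_def omega_def coeff_E)

lemma sigma_in_II2: "i < n \<Longrightarrow> j < n \<Longrightarrow> i \<noteq> j \<Longrightarrow> sigma i j \<in> II2 \<xi>"
  by (auto simp: mem_II2_iff generators_in_II coeff_generators intro!: sum.neutral)

lemma omega_in_II3: "i < n \<Longrightarrow> j < n \<Longrightarrow> omega i j \<in> II3 \<xi>"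
  by (simp add: mem_II3_iff generators_in_II coeff_generators conj_commute)

text \<open>
  The shape in which quarter turns act on index pairs: one index is replaced by a third one. This
  connects any two pairs.
\<close>

lemma all_pairs_from_one:
  assumes sym: "\<And>i j. P i j \<Longrightarrow> P j i"
    and step: "\<And>i j k. i < n \<Longrightarrow> j < n \<Longrightarrow> k < n \<Longrightarrow> i \<noteq> j \<Longrightarrow> i \<noteq> k \<Longrightarrow> j \<noteq> k \<Longrightarrow> P i j \<Longrightarrow> P i k"
    and ab: "P a b" "a < n" "b < n" "a \<noteq> b" and ij: "i < n" "j < n" "i \<noteq> j"
  shows "P i j"
proof -
  have a: "P a k" if "k < n" "k \<noteq> a" for k
    using step[of a b k] ab that by (cases "k = b") auto
  show ?thesis
  proof (cases "i = a")
    case True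
    then show ?thesis using a ij by auto
  next
    case False
    then have "P i a" using a ij sym by blast
    then show ?thesis using step[of i a j] False ab ij by (cases "j = a") auto
  qed
qed

lemma move_sigma:
  assumes "i < n" "j < n" "k < n" "i \<noteq> j" "i \<noteq> k" "j \<noteq> k"
  shows "turn k j (pi/2) (sigma i j) = sigma i k"
  by (rule II_eqI) (use assms in \<open>auto simp: turn_in_II generators_in_II coeff_quarter_turn coeff_generators\<close>)

lemma move_omega:
  assumes "i < n" "j < n" "k < n" "i \<noteq> j" "i \<noteq> k" "j \<noteq> k"
  shows "turn k j (pi/2) (omega i j) = omega i k"
  by (rule II_eqI) (use assms in \<open>auto simp: turn_in_II generators_in_II coeff_quarter_turn coeff_generators\<close>)

text \<open>
  On quadratic forms in the plane a rotation acts with twice its angle, so 45 degrees gives the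
  quarter turn that permutes \<open>sigma\<close> and \<open>delta\<close> up to sign.
\<close>

lemma eighth_turn:
  assumes "a < n" "b < n" "a \<noteq> b"
  shows "turn a b (pi/4) (sigma a b) = delta a b" "turn a b (pi/4) (delta a b) = - sigma a b"
proof -
  show "turn a b (pi/4) (sigma a b) = delta a b"
    by (rule II_eqI) (use assms in \<open>auto simp: turn_in_II generators_in_II coeff_turn coeff_generators
      blinfun.bilinear_simps coeff_def[symmetric] cos_45 sin_45\<close>)
  show "turn a b (pi/4) (delta a b) = - sigma a b"
    by (rule II_eqI) (use assms in \<open>auto simp: turn_in_II generators_in_II coeff_turn coeff_generators
      blinfun.bilinear_simps coeff_def[symmetric] cos_45 sin_45 subspace_neg[OF subspace_II]\<close>)
qed

text \<open>
  With \<open>\<rho>\<close> the quarter turn in the plane \<open>(a, b)\<close>, the operator \<open>(1 - \<rho>) (1 + \<rho>\<^sup>2) / 4\<close> projects symmetric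
  matrices onto the traceless part of the block in that plane: the scalar part of the block and
  the complementary block are fixed by \<open>\<rho>\<close>, the traceless part of the block is negated, and the
  entries linking the two are negated by \<open>\<rho>\<^sup>2\<close>.
\<close>

lemma isolate_symmetric_block:
  assumes N: "SO_submodule \<xi> N" and S: "S \<in> N" "S \<in> II2 \<xi>" and ab: "a < n" "b < n" "a \<noteq> b"
  shows "coeff S a b *\<^sub>R sigma a b + ((coeff S a a - coeff S b b) / 2) *\<^sub>R delta a b \<in> N"
proof -
  have sub: "subspace N" using N by (simp add: SO_submodule_def)
  have II: "S \<in> II \<xi>" and sym: "\<And>i j. i < n \<Longrightarrow> j < n \<Longrightarrow> coeff S i j = coeff S j i"
    using S(2) by (auto simp: mem_II2_iff)
  define R where "R = (1/2) *\<^sub>R (S + turn a b pi S)"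
  define T where "T = (1/2) *\<^sub>R (R - turn a b (pi/2) R)"
  have R: "R \<in> N" unfolding R_def
    by (intro subspace_scale[OF sub] subspace_add[OF sub] turn_in_submodule[OF N] S ab)
  have RII: "R \<in> II \<xi>" unfolding R_def
    by (intro subspace_scale[OF subspace_II] subspace_add[OF subspace_II] turn_in_II II ab)
  have T: "T \<in> N" unfolding T_def
    by (intro subspace_scale[OF sub] subspace_diff[OF sub] turn_in_submodule[OF N] R ab)
  have TII: "T \<in> II \<xi>" unfolding T_def
    by (intro subspace_scale[OF subspace_II] subspace_diff[OF subspace_II] turn_in_II RII ab)
  have cR: "coeff R k l = (if k \<in> {a, b} \<longleftrightarrow> l \<in> {a, b} then coeff S k l else 0)" if "k < n" "l < n" for k l
    unfolding R_def using that ab by (auto simp: coeff_half_turn)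
  have "T = coeff S a b *\<^sub>R sigma a b + ((coeff S a a - coeff S b b) / 2) *\<^sub>R delta a b"
  proof (rule II_eqI[OF TII])
    show "coeff S a b *\<^sub>R sigma a b + ((coeff S a a - coeff S b b) / 2) *\<^sub>R delta a b \<in> II \<xi>"
      using ab by (intro subspace_add[OF subspace_II] subspace_scale[OF subspace_II] generators_in_II)
    fix k l assume kl: "k < n" "l < n"
    show "coeff T k l = coeff (coeff S a b *\<^sub>R sigma a b + ((coeff S a a - coeff S b b) / 2) *\<^sub>R delta a b) k l"
      unfolding T_def using kl ab sym[OF ab(1,2)]
      by (auto simp: coeff_quarter_turn coeff_generators cR field_simps)
  qed
  with T show ?thesis by simp
qed

text \<open>
  The element and its image under the rotation by 45 degrees are orthogonal vectors of equal length in the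
  plane spanned by \<open>sigma\<close> and \<open>delta\<close>, so they span it.
\<close>

lemma sigma_in_submodule:
  assumes N: "SO_submodule \<xi> N" and ab: "a < n" "b < n" "a \<noteq> b"
    and mem: "p *\<^sub>R sigma a b + q *\<^sub>R delta a b \<in> N" and nz: "p \<noteq> 0 \<or> q \<noteq> 0"
  shows "sigma a b \<in> N"
proof -
  have sub: "subspace N" using N by (simp add: SO_submodule_def)
  have rot: "orthogonal_transformation (plane_rotation (e a) (e b) t)" for t
    using ab by (intro orthogonal_plane_rotation) (simp_all add: inner_e)
  have lin: "turn a b t (p *\<^sub>R S + q *\<^sub>R T) = p *\<^sub>R turn a b t S + q *\<^sub>R turn a b t T" for t p q S T
    unfolding turn_def
    by (intro blinfun_eqI)
      (simp add: pullback_apply[OF orthogonal_transformation_linear[OF rot]] blinfun.bilinear_simps)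
  have "turn a b (pi/4) (p *\<^sub>R sigma a b + q *\<^sub>R delta a b) = p *\<^sub>R delta a b - q *\<^sub>R sigma a b"
    by (simp add: lin eighth_turn[OF ab])
  then have turned: "p *\<^sub>R delta a b - q *\<^sub>R sigma a b \<in> N"
    using turn_in_submodule[OF N mem ab] by metis
  \<comment> \<open>This combination eliminates \<open>delta\<close>.\<close>
  have "p *\<^sub>R (p *\<^sub>R sigma a b + q *\<^sub>R delta a b) - q *\<^sub>R (p *\<^sub>R delta a b - q *\<^sub>R sigma a b) \<in> N"
    by (rule subspace_diff[OF sub subspace_scale[OF sub mem] subspace_scale[OF sub turned]])
  also have "p *\<^sub>R (p *\<^sub>R sigma a b + q *\<^sub>R delta a b) - q *\<^sub>R (p *\<^sub>R delta a b - q *\<^sub>R sigma a b) =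
      (p\<^sup>2 + q\<^sup>2) *\<^sub>R sigma a b"
    by (simp add: algebra_simps power2_eq_square)
  finally obtain r where r: "r *\<^sub>R sigma a b \<in> N" "r = p\<^sup>2 + q\<^sup>2" by blast
  then have "r \<noteq> 0" using nz by (simp add: sum_power2_eq_zero_iff)
  then show ?thesis using subspace_scale[OF sub r(1), of "1 / r"] by simp
qed

text \<open>A diagonal matrix with equal entries and trace zero vanishes.\<close>

lemma II2_nonconstant:
  assumes S: "S \<in> II2 \<xi>" "S \<noteq> 0"
  obtains a b where "a < n" "b < n" "a \<noteq> b" "coeff S a b \<noteq> 0 \<or> coeff S a a \<noteq> coeff S b b"
proof (rule ccontr)
  assume "\<not> thesis"
  then have c: "\<And>a b. a < n \<Longrightarrow> b < n \<Longrightarrow> a \<noteq> b \<Longrightarrow> coeff S a b = 0 \<and> coeff S a a = coeff S b b"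
    using that by blast
  have II: "S \<in> II \<xi>" and tr: "(\<Sum>i<n. coeff S i i) = 0" using S by (auto simp: mem_II2_iff)
  have diag: "coeff S i i = 0" if "i < n" for i
  proof -
    have "(\<Sum>j<n. coeff S j j) = (\<Sum>j<n. coeff S i i)"
      using c that by (intro sum.cong refl) (metis lessThan_iff)
    then show ?thesis using tr that by auto
  qed
  have "S = 0"
    by (rule II_eqI[OF II subspace_0[OF subspace_II]]) (use c diag in \<open>metis coeff_linear(5)\<close>)
  with S show False by simp
qed

text \<open>
  Symmetry turns twice the expansion in matrix units into an expansion in \<open>E i j + E j i\<close>; since the trace vanishes,
  a multiple of \<open>E 0 0\<close> may be subtracted from each diagonal term, turning it into \<open>delta i 0\<close>.
\<close>

lemma II2_spanned:
  assumes sub: "subspace N"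
    and gen: "\<And>i j. i < n \<Longrightarrow> j < n \<Longrightarrow> i \<noteq> j \<Longrightarrow> sigma i j \<in> N \<and> delta i j \<in> N"
  shows "II2 \<xi> \<subseteq> N"
proof
  fix S assume S: "S \<in> II2 \<xi>"
  have II: "S \<in> II \<xi>" and sym: "\<And>i j. i < n \<Longrightarrow> j < n \<Longrightarrow> coeff S i j = coeff S j i"
    and tr: "(\<Sum>i<n. coeff S i i) = 0" using S by (auto simp: mem_II2_iff)
  have swap: "(\<Sum>i<n. \<Sum>j<n. coeff S i j *\<^sub>R E j i) = (\<Sum>i<n. \<Sum>j<n. coeff S i j *\<^sub>R E i j)"
    by (subst sum.swap) (intro sum.cong refl, simp add: sym)
  \<comment> \<open>The trace condition, in the form of the multiples of \<open>E 0 0\<close> to be subtracted.\<close>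
  have corr: "(\<Sum>i<n. \<Sum>j<n. if i = j then (2 * coeff S i i) *\<^sub>R E 0 0 else 0) = 0"
    using tr by (simp flip: scaleR_sum_left sum_distrib_left)
  have "2 *\<^sub>R S = (\<Sum>i<n. \<Sum>j<n. coeff S i j *\<^sub>R E i j) + (\<Sum>i<n. \<Sum>j<n. coeff S i j *\<^sub>R E j i)
      - (\<Sum>i<n. \<Sum>j<n. if i = j then (2 * coeff S i i) *\<^sub>R E 0 0 else 0)"
    unfolding swap corr II_eq_sum_E[OF II, symmetric] by (simp add: scaleR_2)
  also have "\<dots> = (\<Sum>i<n. \<Sum>j<n. coeff S i j *\<^sub>R E i j + coeff S i j *\<^sub>R E j i
      - (if i = j then (2 * coeff S i i) *\<^sub>R E 0 0 else 0))"
    by (simp only: sum.distrib sum_subtractf)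
  also have "\<dots> \<in> N"
  proof (intro subspace_sum[OF sub])
    fix i j assume "i \<in> {..<n}" "j \<in> {..<n}"
    then have ij: "i < n" "j < n" by auto
    show "coeff S i j *\<^sub>R E i j + coeff S i j *\<^sub>R E j i
      - (if i = j then (2 * coeff S i i) *\<^sub>R E 0 0 else 0) \<in> N"
    proof (cases "i = j")
      case False
      then have "coeff S i j *\<^sub>R sigma i j \<in> N" using gen ij subspace_scale[OF sub] by blast
      then show ?thesis using False by (simp add: sigma_def scaleR_add_right)
    next
      case True
      have "delta i 0 \<in> N"
        using gen[of i 0] ij subspace_0[OF sub] by (cases "i = 0") (auto simp: delta_def)
      then have "(2 * coeff S i i) *\<^sub>R delta i 0 \<in> N" by (rule subspace_scale[OF sub])
      moreover have "(2 * coeff S i i) *\<^sub>R delta i 0 =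
          coeff S i i *\<^sub>R E i i + coeff S i i *\<^sub>R E i i - (2 * coeff S i i) *\<^sub>R E 0 0"
        by (simp add: delta_def scaleR_diff_right flip: scaleR_add_left)
      ultimately show ?thesis using True by simp
    qed
  qed
  finally have "(1/2) *\<^sub>R (2 *\<^sub>R S) \<in> N" by (rule subspace_scale[OF sub])
  then show "S \<in> N" by simp
qed

lemma irreducible_II2:
  assumes n: "n \<ge> 2"
  shows "irreducible_SO_submodule \<xi> (II2 \<xi>)"
proof (rule irreducible_SO_submoduleI[OF SO_submodule_II2])
  show "sigma 0 1 \<in> II2 \<xi>" using n by (intro sigma_in_II2) auto
  have "coeff (sigma 0 1) 0 1 = 1" using n by (simp add: coeff_generators)
  then show "sigma 0 1 \<noteq> 0" by auto
  fix N S assume N: "SO_submodule \<xi> N" "N \<subseteq> II2 \<xi>" and S: "S \<in> N" "S \<noteq> 0"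
  have sub: "subspace N" using N(1) by (simp add: SO_submodule_def)
  obtain a b where ab: "a < n" "b < n" "a \<noteq> b" "coeff S a b \<noteq> 0 \<or> coeff S a a \<noteq> coeff S b b"
    using II2_nonconstant S N(2) by blast
  have "sigma a b \<in> N"
    using isolate_symmetric_block[OF N(1) S(1) _ ab(1-3)] S(1) N(2) ab(4)
    by (intro sigma_in_submodule[OF N(1) ab(1-3)]) auto
  then have sigma: "sigma i j \<in> N" if "i < n" "j < n" "i \<noteq> j" for i j
    using ab(1-3) that
  proof (rule all_pairs_from_one[where P = "\<lambda>i j. sigma i j \<in> N", rotated 2])
    show "sigma j i \<in> N" if "sigma i j \<in> N" for i j
      using that by (simp add: sigma_def add.commute)
    show "sigma i k \<in> N" if "i < n" "j < n" "k < n" "i \<noteq> j" "i \<noteq> k" "j \<noteq> k" "sigma i j \<in> N" for i j k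
      using turn_in_submodule[OF N(1) that(7), of k j "pi/2"] move_sigma[OF that(1-6)] that by simp
  qed
  have "delta i j \<in> N" if "i < n" "j < n" "i \<noteq> j" for i j
    using turn_in_submodule[OF N(1) sigma[OF that] that] eighth_turn(1)[OF that] by metis
  with sigma show "II2 \<xi> \<subseteq> N" by (intro II2_spanned[OF sub]) blast
qed

lemma II3_spanned:
  assumes sub: "subspace N"
    and gen: "\<And>i j. i < n \<Longrightarrow> j < n \<Longrightarrow> i \<noteq> j \<Longrightarrow> omega i j \<in> N"
  shows "II3 \<xi> \<subseteq> N"
proof
  fix S assume S: "S \<in> II3 \<xi>"
  have II: "S \<in> II \<xi>" and anti: "\<And>i j. i < n \<Longrightarrow> j < n \<Longrightarrow> coeff S i j = - coeff S j i"
    using S unfolding mem_II3_iff by blast+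
  have swap: "(\<Sum>i<n. \<Sum>j<n. coeff S i j *\<^sub>R E j i) = - (\<Sum>i<n. \<Sum>j<n. coeff S i j *\<^sub>R E i j)"
  proof -
    have "(\<Sum>i<n. \<Sum>j<n. coeff S i j *\<^sub>R E j i) = (\<Sum>j<n. \<Sum>i<n. coeff S i j *\<^sub>R E j i)"
      by (rule sum.swap)
    also have "\<dots> = (\<Sum>j<n. \<Sum>i<n. - (coeff S j i *\<^sub>R E j i))"
    proof (intro sum.cong refl)
      fix i j assume "i \<in> {..<n}" "j \<in> {..<n}"
      then have "coeff S j i = - coeff S i j" using anti by blast
      then show "coeff S j i *\<^sub>R E i j = - (coeff S i j *\<^sub>R E i j)" by simp
    qed
    finally show ?thesis by (simp add: sum_negf)
  qed
  have "2 *\<^sub>R S = (\<Sum>i<n. \<Sum>j<n. coeff S i j *\<^sub>R E i j) - (\<Sum>i<n. \<Sum>j<n. coeff S i j *\<^sub>R E j i)"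
    unfolding swap II_eq_sum_E[OF II, symmetric] by (simp add: scaleR_2)
  also have "\<dots> = (\<Sum>i<n. \<Sum>j<n. coeff S i j *\<^sub>R omega i j)"
    by (simp only: sum_subtractf omega_def scaleR_diff_right)
  also have "\<dots> \<in> N"
  proof (intro subspace_sum[OF sub] subspace_scale[OF sub])
    fix i j assume "i \<in> {..<n}" "j \<in> {..<n}"
    then show "omega i j \<in> N"
      using gen[of i j] subspace_0[OF sub] by (cases "i = j") (auto simp: omega_def)
  qed
  finally have "(1/2) *\<^sub>R (2 *\<^sub>R S) \<in> N" by (rule subspace_scale[OF sub])
  then show "S \<in> N" by simp
qed

text \<open>
  Half turns multiply each entry by a sign, so antisymmetrising under one keeps exactly the entries
  that link its plane to the complement. The two planes \<open>(b, c)\<close> and \<open>(a, c)\<close> both do so for the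
  entries at \<open>{a, b}\<close>.
\<close>

lemma isolate_mixed:
  assumes N: "SO_submodule \<xi> N" and S: "S \<in> N" and abc: "a < n" "b < n" "c < n" "a \<noteq> b" "a \<noteq> c" "b \<noteq> c"
  obtains T where "T \<in> N" "\<And>k l. k < n \<Longrightarrow> l < n \<Longrightarrow> coeff T k l =
    (if (k \<in> {b, c}) \<noteq> (l \<in> {b, c}) \<and> (k \<in> {a, c}) \<noteq> (l \<in> {a, c}) then coeff S k l else 0)"
proof
  have sub: "subspace N" using N by (simp add: SO_submodule_def)
  define R where "R = (1/2) *\<^sub>R (S - turn b c pi S)"
  have R: "R \<in> N" unfolding R_def
    by (intro subspace_scale[OF sub] subspace_diff[OF sub] turn_in_submodule[OF N] S abc)
  show "(1/2) *\<^sub>R (R - turn a c pi R) \<in> N"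
    by (intro subspace_scale[OF sub] subspace_diff[OF sub] turn_in_submodule[OF N] R abc)
  have cR: "coeff R k l = (if (k \<in> {b, c}) \<noteq> (l \<in> {b, c}) then coeff S k l else 0)" if "k < n" "l < n" for k l
    unfolding R_def using that abc by (auto simp: coeff_half_turn)
  show "coeff ((1/2) *\<^sub>R (R - turn a c pi R)) k l =
    (if (k \<in> {b, c}) \<noteq> (l \<in> {b, c}) \<and> (k \<in> {a, c}) \<noteq> (l \<in> {a, c}) then coeff S k l else 0)"
    if "k < n" "l < n" for k l
    using that abc by (auto simp: coeff_half_turn cR)
qed

text \<open>
  Besides \<open>{a, b}\<close>, the previous lemma keeps the pairs \<open>{c, x}\<close> with \<open>x\<close> outside \<open>{a, b, c}\<close>. A pair other
  than \<open>{a, b}\<close> cannot meet three distinct values of \<open>c\<close>, and these exist outside \<open>{a, b}\<close> when \<open>n \<ge> 5\<close>.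
\<close>

lemma isolate_antisymmetric_pair:
  assumes n: "n \<noteq> 4" and N: "SO_submodule \<xi> N" and S: "S \<in> N" "S \<in> II3 \<xi>"
    and ab: "a < n" "b < n" "a \<noteq> b"
  obtains T where "T \<in> N" "\<And>k l. k < n \<Longrightarrow> l < n \<Longrightarrow> coeff T k l = coeff S a b * coeff (omega a b) k l"
proof -
  have anti: "\<And>i j. i < n \<Longrightarrow> j < n \<Longrightarrow> coeff S i j = - coeff S j i"
    using S(2) unfolding mem_II3_iff by blast
  have diag: "coeff S i i = 0" if "i < n" for i using anti[OF that that] by simp
  have "n \<ge> 2" using ab by linarith
  then consider "n = 2" | "n = 3" | "n \<ge> 5" using n by linarith
  then show ?thesis
  proof cases
    case 1
    have "coeff S k l = coeff S a b * coeff (omega a b) k l" if "k < n" "l < n" for k l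
    proof -
      have "k = a \<or> k = b" "l = a \<or> l = b" using 1 that ab by linarith+
      then show ?thesis using ab anti[OF ab(2,1)] by (auto simp: coeff_generators diag)
    qed
    with S(1) that show ?thesis by blast
  next
    case 2
    have "\<not> {..<n} \<subseteq> {a, b}"
      using card_mono[of "{a, b}" "{..<n}"] 2 by (auto simp: card_insert_if split: if_splits)
    then obtain c where c: "c < n" "a \<noteq> c" "b \<noteq> c" by blast
    obtain T where T: "T \<in> N" "\<And>k l. k < n \<Longrightarrow> l < n \<Longrightarrow> coeff T k l =
      (if (k \<in> {b, c}) \<noteq> (l \<in> {b, c}) \<and> (k \<in> {a, c}) \<noteq> (l \<in> {a, c}) then coeff S k l else 0)"
      using isolate_mixed[OF N S(1) ab(1,2) c(1) ab(3) c(2,3)] by blast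
    have "coeff T k l = coeff S a b * coeff (omega a b) k l" if "k < n" "l < n" for k l
    proof -
      have "k = a \<or> k = b \<or> k = c" "l = a \<or> l = b \<or> l = c" using 2 that ab c by linarith+
      then show ?thesis using ab c anti[OF ab(2,1)] by (auto simp: coeff_generators T(2))
    qed
    with T(1) that show ?thesis by blast
  next
    case 3
    have "3 \<le> card ({..<n} - {a, b})"
      using 3 ab by (simp add: card_Diff_subset)
    then obtain C where C: "C \<subseteq> {..<n} - {a, b}" "card C = 3"
      by (rule obtain_subset_with_card_n)
    obtain c d f where "C = {c, d, f}" "c \<noteq> d" "c \<noteq> f" "d \<noteq> f"
      using C(2) unfolding card_3_iff by blast
    with C(1) that have cdf: "c < n" "a \<noteq> c" "b \<noteq> c" "d < n" "a \<noteq> d" "b \<noteq> d" "f < n" "a \<noteq> f" "b \<noteq> f"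
      "c \<noteq> d" "c \<noteq> f" "d \<noteq> f"
      by blast+
    obtain R where R: "R \<in> N" "\<And>k l. k < n \<Longrightarrow> l < n \<Longrightarrow> coeff R k l =
      (if (k \<in> {b, c}) \<noteq> (l \<in> {b, c}) \<and> (k \<in> {a, c}) \<noteq> (l \<in> {a, c}) then coeff S k l else 0)"
      using isolate_mixed[OF N S(1) ab(1,2) cdf(1) ab(3) cdf(2,3)] by blast
    obtain Q where Q: "Q \<in> N" "\<And>k l. k < n \<Longrightarrow> l < n \<Longrightarrow> coeff Q k l =
      (if (k \<in> {b, d}) \<noteq> (l \<in> {b, d}) \<and> (k \<in> {a, d}) \<noteq> (l \<in> {a, d}) then coeff R k l else 0)"
      using isolate_mixed[OF N R(1) ab(1,2) cdf(4) ab(3) cdf(5,6)] by blast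
    obtain T where T: "T \<in> N" "\<And>k l. k < n \<Longrightarrow> l < n \<Longrightarrow> coeff T k l =
      (if (k \<in> {b, f}) \<noteq> (l \<in> {b, f}) \<and> (k \<in> {a, f}) \<noteq> (l \<in> {a, f}) then coeff Q k l else 0)"
      using isolate_mixed[OF N Q(1) ab(1,2) cdf(7) ab(3) cdf(8,9)] by blast
    have "coeff T k l = coeff S a b * coeff (omega a b) k l" if kl: "k < n" "l < n" for k l
    proof -
      define kept where "kept m \<longleftrightarrow> (k \<in> {b, m}) \<noteq> (l \<in> {b, m}) \<and> (k \<in> {a, m}) \<noteq> (l \<in> {a, m})" for m
      have "coeff T k l = (if kept f \<and> kept d \<and> kept c then coeff S k l else 0)"
        by (simp only: T(2)[OF kl] Q(2)[OF kl] R(2)[OF kl] kept_def[symmetric] if_if_eq_conj)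
      moreover have "kept f \<and> kept d \<and> kept c \<longleftrightarrow> k = a \<and> l = b \<or> k = b \<and> l = a"
        unfolding kept_def using cdf ab(3) by blast
      ultimately have "coeff T k l = (if k = a \<and> l = b \<or> k = b \<and> l = a then coeff S k l else 0)"
        by simp
      then show ?thesis using ab anti[OF ab(2,1)] kl by (auto simp: coeff_generators)
    qed
    with T(1) that show ?thesis by blast
  qed
qed

lemma irreducible_II3:
  assumes n: "n \<ge> 2" "n \<noteq> 4"
  shows "irreducible_SO_submodule \<xi> (II3 \<xi>)"
proof (rule irreducible_SO_submoduleI[OF SO_submodule_II3])
  show "omega 0 1 \<in> II3 \<xi>" using n by (intro omega_in_II3) auto
  have "coeff (omega 0 1) 0 1 = 1" using n by (simp add: coeff_generators)
  then show "omega 0 1 \<noteq> 0" by auto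
  fix N S assume N: "SO_submodule \<xi> N" "N \<subseteq> II3 \<xi>" and S: "S \<in> N" "S \<noteq> 0"
  have sub: "subspace N" using N(1) by (simp add: SO_submodule_def)
  have S3: "S \<in> II3 \<xi>" and II: "S \<in> II \<xi>" using S(1) N(2) unfolding II3_def by blast+
  obtain a b where ab: "a < n" "b < n" "coeff S a b \<noteq> 0"
    using II_eqI[OF II subspace_0[OF subspace_II]] S(2) by auto
  have "a \<noteq> b"
  proof
    assume "a = b"
    moreover have "coeff S a b = - coeff S b a" using S3 ab unfolding mem_II3_iff by blast
    ultimately show False using ab(3) by simp
  qed
  note ab = ab(1,2) this ab(3)
  obtain T where T: "T \<in> N" "\<And>k l. k < n \<Longrightarrow> l < n \<Longrightarrow> coeff T k l = coeff S a b * coeff (omega a b) k l"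
    using isolate_antisymmetric_pair[OF n(2) N(1) S(1) S3 ab(1-3)] by blast
  have "(1 / coeff S a b) *\<^sub>R T \<in> N" by (rule subspace_scale[OF sub T(1)])
  moreover have "(1 / coeff S a b) *\<^sub>R T = omega a b"
  proof (rule II_eqI)
    have "T \<in> II \<xi>" using T(1) N(2) unfolding II3_def by blast
    then show "(1 / coeff S a b) *\<^sub>R T \<in> II \<xi>" by (rule subspace_scale[OF subspace_II])
  qed (use T(2) ab in \<open>simp_all add: generators_in_II\<close>)
  ultimately have "omega a b \<in> N" by simp
  then have "omega i j \<in> N" if "i < n" "j < n" "i \<noteq> j" for i j
    using ab(1-3) that
  proof (rule all_pairs_from_one[where P = "\<lambda>i j. omega i j \<in> N", rotated 2])
    show "omega j i \<in> N" if "omega i j \<in> N" for i j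
      using subspace_neg[OF sub that] by (simp add: omega_def)
    show "omega i k \<in> N" if "i < n" "j < n" "k < n" "i \<noteq> j" "i \<noteq> k" "j \<noteq> k" "omega i j \<in> N" for i j k
      using turn_in_submodule[OF N(1) that(7), of k j "pi/2"] move_omega[OF that(1-6)] that by simp
  qed
  then show "II3 \<xi> \<subseteq> N" by (intro II3_spanned[OF sub]) blast
qed

text \<open>
  An empty matrix is zero, and a traceless or skew-symmetric matrix of size one has nothing but a
  vanishing diagonal entry.
\<close>

lemma small_dimension:
  "n = 0 \<Longrightarrow> II1 \<xi> = {0}" "n < 2 \<Longrightarrow> II2 \<xi> = {0}" "n < 2 \<Longrightarrow> II3 \<xi> = {0}"
proof -
  have zero: "S = 0" if "S \<in> II \<xi>" "\<And>i j. i < n \<Longrightarrow> j < n \<Longrightarrow> coeff S i j = 0" for S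
    using II_eqI[OF that(1) subspace_0[OF subspace_II]] that(2) by simp
  show "II1 \<xi> = {0}" if "n = 0"
    using zero that subspace_0[OF subspace_II1] by (auto simp: mem_II1_iff)
  show "II2 \<xi> = {0}" if "n < 2"
  proof -
    have "S = 0" if S: "S \<in> II2 \<xi>" for S
    proof (rule ccontr)
      assume "S \<noteq> 0"
      then obtain a b where "a < n" "b < n" "a \<noteq> b" using II2_nonconstant[OF S] by metis
      with \<open>n < 2\<close> show False by linarith
    qed
    then show ?thesis using subspace_0[OF subspace_II2] by auto
  qed
  show "II3 \<xi> = {0}" if "n < 2"
  proof -
    have "S = 0" if S: "S \<in> II3 \<xi>" for S
    proof (rule zero)
      show "S \<in> II \<xi>" using S unfolding II3_def by blast
      fix i j assume ij: "i < n" "j < n"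
      with \<open>n < 2\<close> have "i = j" by linarith
      moreover have "coeff S i j = - coeff S j i" using S ij unfolding mem_II3_iff by blast
      ultimately show "coeff S i j = 0" by simp
    qed
    then show ?thesis using subspace_0[OF subspace_II3] by auto
  qed
qed

end

theorem proposition5p3:
  fixes \<xi> :: "'v::euclidean_space" and n :: nat
  assumes "DIM('v) = n + 1" and "norm \<xi> = 1"
  shows "(\<forall>(S :: 'v trilinear_form) Y e. S \<in> II \<xi> \<longrightarrow> orthonormal_basis (D \<xi>) e \<longrightarrow> c13 \<xi> S Y = (\<Sum>i<n. S (e i) Y (e i))) \<and>
    SO_submodule \<xi> (II \<xi>) \<and>
    SO_submodule \<xi> (II1 \<xi>) \<and> SO_submodule \<xi> (II2 \<xi>) \<and> SO_submodule \<xi> (II3 \<xi>) \<and>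
    bij_betw (\<lambda>(S1, S2, S3). S1 + S2 + S3) (II1 \<xi> \<times> II2 \<xi> \<times> II3 \<xi>) (II \<xi>) \<and>
    (if n \<ge> 1 then irreducible_SO_submodule \<xi> (II1 \<xi>) else II1 \<xi> = {0}) \<and>
    (if n \<ge> 2 then irreducible_SO_submodule \<xi> (II2 \<xi>) else II2 \<xi> = {0}) \<and>
    (if n \<ge> 2 then n \<noteq> 4 \<longrightarrow> irreducible_SO_submodule \<xi> (II3 \<xi>) else II3 \<xi> = {0})"
proof -
  interpret adapted_basis \<xi> n "some_onb (D \<xi>)"
    using assms by unfold_locales (simp_all add: some_onb subspace_D)
  show ?thesis
    using c13_eq_sum SO_submodule_II SO_submodule_II1 SO_submodule_II2 SO_submodule_II3
      bij_betw_sum_parts irreducible_II1 irreducible_II2 irreducible_II3 small_dimension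
    by (simp add: not_le)
qed

end
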